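(* Let $X$ and $Y$ be separable reflexive Banach spaces with the approximation property. (1) If either $K(X)$ is a u-ideal in $B(X)$ or $K(Y)$ is a u-ideal in $B(Y)$, then for all $1/2<\alpha\le1$ the renormed space $Z_\alpha=(B(X,Y),\|\cdot\|_\alpha)$ has the $(2\alpha,2\alpha-1-\sigma)$-UBCP for all $0<\sigma<2\alpha-1$. (2) If either $K(X)$ has the ball intersection property in $B(X)$ or $K(Y)$ has the ball intersection property in $B(Y)$, then for all $1/2<\alpha\le1$ the renormed space $Z_\alpha=(B(X,Y),\|\cdot\|_\alpha)$ has the $(2\alpha,2\alpha-1-\sigma)$-UBCP for all $0<\sigma<2\alpha-1$.
   Context: $B(X,Y)$ is the space of bounded linear operators with operator norm $\|\cdot\|$, $K(X,Y)$ the subspace of compact operators; $B(X)=B(X,X)$, $K(X)=K(X,X)$. For $\alpha\in[0,1]$, $\|T\|_\alpha=\alpha\|T\|+(1-\alpha)\|T\|_{B(X,Y)/K(X,Y)}$, where the last term is the quotient norm of the class of $T$. Approximation property of $X$: for every compact $K\subseteq X$ and $\varepsilon>0$ there is a finite rank operator $S$ on $X$ with $\|Sx-x\|\le\varepsilon$ for all $x\in K$. u-ideal: a closed subspace $E$ of a Banach space $F$ is a u-ideal in $F$ if there is a projection $P$ of $F^*$ onto $E^\perp$ (the annihilator of $E$) with $\|id-2P\|=1$. Ball intersection property of a closed subspace $E$ in a Banach space $F$: for every $y\in F\setminus E$, with $Z=\operatorname{span}(E,\{y\})$, one has $E\cap\bigcap_{i=1}^nB_Z(y+x_i,\|y-x_i\|+\varepsilon)\ne\emptyset$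 for every finite collection $(x_i)_{i=1}^n\subseteq E$ and every $\varepsilon>0$, where $B_Z(z,r)$ is the closed ball in $Z$. (By a known theorem of V. Lima and \AA. Lima, for each $y$ this is equivalent to the same condition restricted to collections of three points, and to $E$ being a u-ideal in $Z$.) $(r,\delta)$-UBCP (uniform ball-covering property; $r,\delta>0$): a normed space $Z$ has it if there are countably many closed balls $B(z_n,r_n)$ in $Z$ whose union contains the unit sphere of $Z$, with $r_n<\|z_n\|$, $r_n\le r$ and $B(z_n,r_n)\cap B(0,\delta)=\emptyset$ for all $n$. *)

theory Defs
  imports "HOL-Analysis.Analysis"
begin

text \<open>
  Banach spaces are real and are given by types of class \<^class>\<open>banach\<close>; $B(X,Y)$ is the type of
  bounded linear operators \<open>'x \<Rightarrow>\<^sub>L 'y\<close> with its operator norm, and the dual of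
  \<open>'f\<close> is \<open>'f \<Rightarrow>\<^sub>L real\<close>.
\<close>

text \<open>The canonical embedding of the space into its bidual is onto.\<close>

definition reflexive_space :: "'a::real_normed_vector itself \<Rightarrow> bool" where
  "reflexive_space _ \<longleftrightarrow>
     (\<forall>\<Phi> :: ('a \<Rightarrow>\<^sub>L real) \<Rightarrow>\<^sub>L real. \<exists>x::'a. \<forall>f. blinfun_apply \<Phi> f = blinfun_apply f x)"

definition finite_rank :: "('a::real_normed_vector \<Rightarrow>\<^sub>L 'b::real_normed_vector) \<Rightarrow> bool" where
  "finite_rank S \<longleftrightarrow> (\<exists>B. finite B \<and> range (blinfun_apply S) \<subseteq> span B)"

definition approximation_property :: "'a::real_normed_vector itself \<Rightarrow> bool" where
  "approximation_property _ \<longleftrightarrow>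
     (\<forall>C::'a set. \<forall>\<epsilon>>0. compact C \<longrightarrow>
        (\<exists>S::'a \<Rightarrow>\<^sub>L 'a. finite_rank S \<and> (\<forall>x\<in>C. norm (blinfun_apply S x - x) \<le> \<epsilon>)))"

definition compact_operators :: "('a::real_normed_vector \<Rightarrow>\<^sub>L 'b::real_normed_vector) set" where
  "compact_operators = {T. compact (closure (blinfun_apply T ` cball 0 1))}"

definition quotient_norm :: "'f::real_normed_vector set \<Rightarrow> 'f \<Rightarrow> real" where
  "quotient_norm E x = (INF e\<in>E. norm (x + e))"

definition alpha_norm ::
    "real \<Rightarrow> ('a::real_normed_vector \<Rightarrow>\<^sub>L 'b::real_normed_vector) \<Rightarrow> real" where
  "alpha_norm \<alpha> T = \<alpha> * norm T + (1 - \<alpha>) * quotient_norm compact_operators T"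

definition annihilator :: "'f::real_normed_vector set \<Rightarrow> ('f \<Rightarrow>\<^sub>L real) set" where
  "annihilator E = {\<phi>. \<forall>x\<in>E. blinfun_apply \<phi> x = 0}"

text \<open>
  Requiring the projection \<open>P\<close> to be bounded loses nothing, since $\|id - 2P\| = 1$ forces it.
\<close>

definition u_ideal :: "'f::banach set \<Rightarrow> bool" where
  "u_ideal E \<longleftrightarrow> subspace E \<and> closed E \<and>
     (\<exists>P :: ('f \<Rightarrow>\<^sub>L real) \<Rightarrow>\<^sub>L ('f \<Rightarrow>\<^sub>L real).
        P o\<^sub>L P = P \<and> range (blinfun_apply P) = annihilator E \<and>
        norm (id_blinfun - 2 *\<^sub>R P) = 1)"

text \<open>
  The closed balls of \<open>span (insert y E)\<close> are the traces of the closed balls of the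
  ambient space; a finite collection in \<open>E\<close> is given by the finite set \<open>A\<close> of its members.
\<close>

definition ball_intersection_property :: "'f::banach set \<Rightarrow> bool" where
  "ball_intersection_property E \<longleftrightarrow> subspace E \<and> closed E \<and>
     (\<forall>y. y \<notin> E \<longrightarrow> (\<forall>A \<epsilon>. finite A \<and> A \<subseteq> E \<and> \<epsilon> > 0 \<longrightarrow>
        E \<inter> (\<Inter>x\<in>A. cball (y + x) (norm (y - x) + \<epsilon>) \<inter> span (insert y E)) \<noteq> {}))"

definition norm_cball :: "('z::real_vector \<Rightarrow> real) \<Rightarrow> 'z \<Rightarrow> real \<Rightarrow> 'z set" where
  "norm_cball N z r = {w. N (w - z) \<le> r}"

text \<open>
  The uniform ball-covering property of the vector space \<open>'z\<close> under the norm \<open>N\<close>, which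
  is an argument because it need not be the norm that the type carries.  The covering family is a
  countable set of pairs (centre, radius); it may be finite, and it is empty when \<open>'z\<close> is
  the zero space, whose unit sphere is empty.
\<close>

definition UBCP :: "('z::real_vector \<Rightarrow> real) \<Rightarrow> real \<Rightarrow> real \<Rightarrow> bool" where
  "UBCP N r \<delta> \<longleftrightarrow>
     (\<exists>\<B> :: ('z \<times> real) set. countable \<B> \<and>
        {z. N z = 1} \<subseteq> (\<Union>(c, s)\<in>\<B>. norm_cball N c s) \<and>
        (\<forall>(c, s)\<in>\<B>. 0 < s \<and> s < N c \<and> s \<le> r \<and> norm_cball N c s \<inter> norm_cball N 0 \<delta> = {}))"

end

theory Submission
  imports Defs
begin

text \<open>
  The unit ball of a separable reflexive space has small slices, given by functionals that are
  dense in the dual.  If $f$ attains its norm $c$ at $x$ and gives such a slice, then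
  $\|t\, x \otimes f - id\| \le tc - 1 + \varepsilon$ for large $t$.  Intersecting the two balls around
  $id$ and $id + S$, $S = t\, x \otimes f$, yields a compact $K$ with $\|id - K\| \le 1 + \varepsilon$ and
  $f(Kx) \approx 2c$.  A u-ideal has this intersection property for two balls: otherwise a functional
  separating the diagonal of $E \times E$ from the product of the balls contradicts
  $\|id - 2P\| = 1$.

  Composing $T : X \to Y$ with $K$ on the appropriate side gives a compact $C$ with
  $\|T - C\| \le (1 + \varepsilon)\|T\|$ and $\|C\| \ge 2\|T\| - \varepsilon$.  Subtracting a compact
  operator does not change the quotient norm, so balls of radius $1 + \varepsilon$ around the elements of a
  countable dense set of compact operators cover the sphere.
\<close>

section \<open>Hahn--Banach from sublinear functionals\<close>

text \<open>The factor 2 comes from the -1 in the estimate for t x \<otimes> f - id: adding id to S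
  = t x \<otimes> f raises the value of f at x by c, whereas subtracting id lowers the norm bound by
  about 1, so K has to make up for both. A covering ball thus has a centre of \<alpha>-norm about
  2\<alpha> and radius about 1, which leaves a gap of about 2\<alpha> - 1 around 0; \<sigma> pays
  for all approximations.

  A hypothesis on X gives a K acting before T, which must nearly double the norm of a functional g o
  T; a hypothesis on Y gives a K acting after T, which must nearly double the norm of a vector T x.
  Hence slices are needed both in the ball of the space, given by functionals, and in the ball of
  the dual, given by points.

  The countable set of centres rests on density of the finite rank operators, which the
  approximation property of Y provides, and on separability of Y and of the dual of X.

  Hahn--Banach is set up for sublinear functionals because the separation of two balls of different
  radii uses a weighted maximum on a product as its gauge.\<close>

definition sublinear :: "('a::real_vector \<Rightarrow> real) \<Rightarrow> bool" where
  "sublinear p \<longleftrightarrow> (\<forall>x y. p (x + y) \<le> p x + p y) \<and> (\<forall>c>0. \<forall>x. p (c *\<^sub>R x) \<le> c * p x)"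

lemma sublinearI:
  assumes "\<And>x y. p (x + y) \<le> p x + p y" "\<And>c x. c > 0 \<Longrightarrow> p (c *\<^sub>R x) \<le> c * p x"
  shows "sublinear p"
  using assms by (simp add: sublinear_def)

lemma sublinear_add: "sublinear p \<Longrightarrow> p (x + y) \<le> p x + p y"
  by (simp add: sublinear_def)

lemma sublinear_scale_le: "sublinear p \<Longrightarrow> c > 0 \<Longrightarrow> p (c *\<^sub>R x) \<le> c * p x"
  by (simp add: sublinear_def)

lemma sublinear_0:
  assumes "sublinear p" shows "p 0 = 0"
  using sublinear_scale_le[OF assms, of 2 0] sublinear_scale_le[OF assms, of "1/2" 0] by simp

text \<open>The reverse inequality is the assumed one for the factor 1/c. Demanding a single
  inequality in the definition shortens each construction of a sublinear functional as an
  infimum.\<close>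

lemma sublinear_scale:
  assumes "sublinear p" "c \<ge> 0" shows "p (c *\<^sub>R x) = c * p x"
proof (cases "c = 0")
  case True then show ?thesis using sublinear_0[OF assms(1)] by simp
next
  case False
  with assms have c: "c > 0" by simp
  have "p ((1/c) *\<^sub>R (c *\<^sub>R x)) \<le> (1/c) * p (c *\<^sub>R x)"
    using c by (intro sublinear_scale_le[OF assms(1)]) simp
  then have "c * p x \<le> p (c *\<^sub>R x)" using c by (simp add: field_simps)
  with sublinear_scale_le[OF assms(1) c] show ?thesis by (simp add: antisym)
qed

lemma sublinear_minus:
  assumes "sublinear p" shows "- p (- x) \<le> p x"
  using sublinear_add[OF assms, of x "- x"] sublinear_0[OF assms] by simp

lemma sublinear_direction:
  assumes "sublinear p"
  obtains q where "sublinear q" "\<And>x. q x \<le> p x" "q (- z) \<le> - p z"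
proof -
  \<comment> \<open>This is the largest sublinear functional below \<open>p\<close> whose value at
    \<open>- z\<close> is at most \<open>- p z\<close>: any such r satisfies r(x) \<le> r(x + tz) +
    t r(-z) \<le> p(x + tz) - t p(z) for t \<ge> 0.\<close>
  define q where "q x = (INF t\<in>{0..}. p (x + t *\<^sub>R z) - t * p z)" for x
  have bdd: "bdd_below ((\<lambda>t. p (x + t *\<^sub>R z) - t * p z) ` {0..})" for x
  proof (rule bdd_belowI2)
    fix t :: real assume "t \<in> {0..}"
    then have "t * p z = p ((x + t *\<^sub>R z) + (- x))" using sublinear_scale[OF assms] by simp
    also have "\<dots> \<le> p (x + t *\<^sub>R z) + p (- x)" by (rule sublinear_add[OF assms])
    finally show "- p (- x) \<le> p (x + t *\<^sub>R z) - t * p z" by simp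
  qed
  have le: "q x \<le> p (x + t *\<^sub>R z) - t * p z" if "t \<ge> 0" for x t
    unfolding q_def using that by (intro cINF_lower[OF bdd]) simp
  have ge: "b \<le> q x" if "\<And>t. t \<ge> 0 \<Longrightarrow> b \<le> p (x + t *\<^sub>R z) - t * p z" for b x
    unfolding q_def using that by (intro cINF_greatest) auto
  have "sublinear q"
  proof (rule sublinearI)
    fix x y
    \<comment> \<open>The parameters \<open>t\<close> and \<open>s\<close> of the two summands
      combine to the parameter \<open>t + s\<close> of the sum; the infima over \<open>s\<close> and
      over \<open>t\<close> are taken one at a time.\<close>
    have *: "q (x + y) - (p (x + t *\<^sub>R z) - t * p z) \<le> q y" if t: "t \<ge> 0" for t
    proof (rule ge)
      fix s :: real assume s: "s \<ge> 0"
      have "q (x + y) \<le> p ((x + y) + (t + s) *\<^sub>R z) - (t + s) * p z"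
        using s t by (intro le) simp
      moreover have "p ((x + y) + (t + s) *\<^sub>R z) = p ((x + t *\<^sub>R z) + (y + s *\<^sub>R z))"
        by (simp add: algebra_simps)
      ultimately show "q (x + y) - (p (x + t *\<^sub>R z) - t * p z) \<le> p (y + s *\<^sub>R z) - s * p z"
        using sublinear_add[OF assms, of "x + t *\<^sub>R z" "y + s *\<^sub>R z"] by (simp add: algebra_simps)
    qed
    have "q (x + y) - q y \<le> q x" using * by (intro ge) force
    then show "q (x + y) \<le> q x + q y" by simp
  next
    fix c :: real and x assume c: "c > 0"
    have "q (c *\<^sub>R x) / c \<le> q x"
    proof (rule ge)
      fix t :: real assume t: "t \<ge> 0"
      have "q (c *\<^sub>R x) \<le> p (c *\<^sub>R x + (c * t) *\<^sub>R z) - (c * t) * p z"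
        using c t by (intro le) simp
      also have "p (c *\<^sub>R x + (c * t) *\<^sub>R z) = c * p (x + t *\<^sub>R z)"
        using sublinear_scale[OF assms, of c "x + t *\<^sub>R z"] c by (simp add: algebra_simps)
      finally show "q (c *\<^sub>R x) / c \<le> p (x + t *\<^sub>R z) - t * p z"
        using c by (simp add: field_simps)
    qed
    then show "q (c *\<^sub>R x) \<le> c * q x" using c by (simp add: field_simps)
  qed
  moreover have "q x \<le> p x" for x using le[of 0 x] by simp
  moreover have "q (- z) \<le> - p z" using le[of 1 "- z"] sublinear_0[OF assms] by simp
  ultimately show ?thesis by (rule that)
qed

text \<open>By \<open>sublinear_direction\<close>, a minimal sublinear functional is odd, hence linear.\<close>

lemma sublinear_minimal:
  fixes p :: "'a::real_vector \<Rightarrow> real"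
  assumes "sublinear p"
  obtains m where "sublinear m" "\<And>x. m x \<le> p x"
    "\<And>q. sublinear q \<Longrightarrow> (\<And>x. q x \<le> m x) \<Longrightarrow> q = m"
proof -
  define A where "A = {q. sublinear q \<and> (\<forall>x. q x \<le> p x)}"
  \<comment> \<open>The order is reversed, so that the bound of a chain that Zorn's lemma asks for
    is a pointwise infimum and a maximal element is a minimal functional.\<close>
  define P where "P = (\<lambda>a b :: 'a \<Rightarrow> real. \<forall>x. b x \<le> a x)"
  have "\<exists>m\<in>A. \<forall>a\<in>A. P m a \<longrightarrow> a = m"
  proof (rule predicate_Zorn)
    show "partial_order_on A (relation_of P A)"
      by (rule partial_order_on_relation_ofI) (auto simp: P_def fun_eq_iff intro: order_trans antisym)
  next
    fix C assume C: "C \<in> Chains (relation_of P A)"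
    then have CA: "C \<subseteq> A" and chain: "\<And>a b. a \<in> C \<Longrightarrow> b \<in> C \<Longrightarrow> P a b \<or> P b a"
      by (auto simp: Chains_def relation_of_def)
    show "\<exists>u\<in>A. \<forall>a\<in>C. P a u"
    proof (cases "C = {}")
      case True
      with assms show ?thesis by (auto simp: A_def)
    next
      case False
      define u where "u x = (INF q\<in>C. q x)" for x
      have bdd: "bdd_below ((\<lambda>q. q x) ` C)" for x
      proof (rule bdd_belowI2)
        fix q assume "q \<in> C"
        then have "sublinear q" "q (- x) \<le> p (- x)" using CA by (auto simp: A_def)
        then show "- p (- x) \<le> q x" using sublinear_minus[of q x] by simp
      qed
      have le: "u x \<le> q x" if "q \<in> C" for x q
        unfolding u_def using that by (intro cINF_lower[OF bdd])
      have ge: "b \<le> u x" if "\<And>q. q \<in> C \<Longrightarrow> b \<le> q x" for b x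
        unfolding u_def using that False by (intro cINF_greatest) auto
      have sub: "sublinear q" if "q \<in> C" for q using CA that by (auto simp: A_def)
      have "sublinear u"
      proof (rule sublinearI)
        fix x y
        have *: "u (x + y) - q x \<le> u y" if q: "q \<in> C" for q
        proof (rule ge)
          fix r assume r: "r \<in> C"
          \<comment> \<open>The chain condition enters here: subadditivity of the smaller of
            \<open>q\<close> and \<open>r\<close> bounds \<open>u (x + y)\<close> by
            \<open>q x + r y\<close>.\<close>
          show "u (x + y) - q x \<le> r y"
            using chain[OF q r] le[OF q, of "x + y"] le[OF r, of "x + y"]
              sublinear_add[OF sub[OF q], of x y] sublinear_add[OF sub[OF r], of x y]
            unfolding P_def by (smt (verit))
        qed
        have "u (x + y) - u y \<le> u x" using * by (intro ge) force
        then show "u (x + y) \<le> u x + u y" by simp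
      next
        fix c :: real and x assume c: "c > 0"
        have "u (c *\<^sub>R x) / c \<le> u x"
        proof (rule ge)
          fix q assume q: "q \<in> C"
          show "u (c *\<^sub>R x) / c \<le> q x"
            using order_trans[OF le[OF q] sublinear_scale_le[OF sub[OF q] c]] c
            by (simp add: field_simps)
        qed
        then show "u (c *\<^sub>R x) \<le> c * u x" using c by (simp add: field_simps)
      qed
      moreover have "u x \<le> p x" for x
      proof -
        obtain q where q: "q \<in> C" using False by blast
        then have "q x \<le> p x" using CA by (auto simp: A_def)
        with le[OF q, of x] show ?thesis by simp
      qed
      ultimately show ?thesis using le by (auto simp: A_def P_def)
    qed
  qed
  then obtain m where m: "m \<in> A" "\<And>a. a \<in> A \<Longrightarrow> P m a \<Longrightarrow> a = m" by blast
  show ?thesis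
  proof (rule that)
    show "sublinear m" "\<And>x. m x \<le> p x" using m(1) by (auto simp: A_def)
    fix q assume "sublinear q" "\<And>x. q x \<le> m x"
    then show "q = m"
      using m(1) by (intro m(2)) (auto simp: A_def P_def intro: order_trans)
  qed
qed

text \<open>Lowering \<open>p\<close> in the direction \<open>z\<close> before passing to a minimal
  functional prescribes the value there: oddness turns m(-z) \<le> -p(z) into m(z) \<ge>
  p(z).\<close>

theorem hahn_banach:
  fixes p :: "'a::real_vector \<Rightarrow> real"
  assumes "sublinear p"
  obtains F where "linear F" "\<And>x. F x \<le> p x" "F z = p z"
proof -
  obtain p' where p': "sublinear p'" "\<And>x. p' x \<le> p x" "p' (- z) \<le> - p z"
    using sublinear_direction[OF assms] by blast
  obtain m where m: "sublinear m" "\<And>x. m x \<le> p' x"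
    "\<And>q. sublinear q \<Longrightarrow> (\<And>x. q x \<le> m x) \<Longrightarrow> q = m"
    using sublinear_minimal[OF p'(1)] by blast
  have neg: "m (- x) = - m x" for x
  proof -
    obtain q where q: "sublinear q" "\<And>y. q y \<le> m y" "q (- x) \<le> - m x"
      using sublinear_direction[OF m(1)] by blast
    with m(3) have "q = m" by blast
    with q(3) sublinear_minus[OF m(1), of x] show ?thesis by simp
  qed
  have "linear m"
  proof (rule linearI)
    fix x y
    show "m (x + y) = m x + m y"
      using sublinear_add[OF m(1), of x y] sublinear_add[OF m(1), of "- x" "- y"]
        neg[of x] neg[of y] neg[of "x + y"] by (simp add: algebra_simps)
  next
    fix c x
    show "m (c *\<^sub>R x) = c *\<^sub>R m x"
    proof (cases "c \<ge> 0")
      case True then show ?thesis using sublinear_scale[OF m(1)] by simp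
    next
      case False
      then have "m ((- c) *\<^sub>R x) = - c * m x" by (intro sublinear_scale[OF m(1)]) simp
      with neg[of "c *\<^sub>R x"] show ?thesis by simp
    qed
  qed
  moreover have "m x \<le> p x" for x using m(2) p'(2) order_trans by blast
  moreover have "m z = p z"
    using neg[of z] m(2)[of "- z"] p'(3) \<open>m z \<le> p z\<close> by simp
  ultimately show ?thesis by (rule that)
qed

section \<open>Bounded functionals: norming a vector, separating from a subspace\<close>

lemma blinfun_of_linear_bound:
  fixes F :: "'a::real_normed_vector \<Rightarrow> real"
  assumes "linear F" "\<And>x. F x \<le> C * norm x" "C \<ge> 0"
  obtains f :: "'a \<Rightarrow>\<^sub>L real" where "blinfun_apply f = F" "norm f \<le> C"
proof -
  have b: "norm (F x) \<le> C * norm x" for x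
    using assms(2)[of x] assms(2)[of "- x"] linear_neg[OF assms(1), of x] by (simp add: abs_le_iff)
  then have "bounded_linear F"
    using assms(1) by (intro bounded_linear_intro[where K = C])
      (auto simp: linear_add linear_scale mult.commute)
  then have *: "blinfun_apply (Blinfun F) = F" by (rule bounded_linear_Blinfun_apply)
  show ?thesis
    by (rule that[OF *], rule norm_blinfun_bound) (use b assms(3) in \<open>auto simp: *\<close>)
qed

lemma norming_functional:
  fixes z :: "'a::real_normed_vector"
  obtains f :: "'a \<Rightarrow>\<^sub>L real" where "norm f \<le> 1" "blinfun_apply f z = norm z"
proof -
  have "sublinear (norm :: 'a \<Rightarrow> real)" by (rule sublinearI) (auto simp: norm_triangle_ineq)
  then obtain F :: "'a \<Rightarrow> real" where F: "linear F" "\<And>x. F x \<le> norm x" "F z = norm z"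
    using hahn_banach by blast
  obtain f :: "'a \<Rightarrow>\<^sub>L real" where "blinfun_apply f = F" "norm f \<le> 1"
    using blinfun_of_linear_bound[OF F(1), of 1] F(2) by auto
  with F(3) that show ?thesis by simp
qed

lemma sublinear_infimum_modulo:
  fixes N :: "'a::real_vector \<Rightarrow> real"
  assumes N: "sublinear N" "\<And>x. N x \<ge> 0" and E: "subspace E"
  shows "sublinear (\<lambda>x. INF e\<in>E. N (x - e))"
proof -
  have ne: "E \<noteq> {}" using subspace_0[OF E] by blast
  have bdd: "bdd_below ((\<lambda>e. N (x - e)) ` E)" for x
    using N(2) by (intro bdd_belowI2[where m = 0]) auto
  have le: "(INF e\<in>E. N (x - e)) \<le> N (x - e)" if "e \<in> E" for x e
    using that by (rule cINF_lower[OF bdd])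
  show ?thesis
  proof (rule sublinearI)
    fix x y
    have "(INF e\<in>E. N (x + y - e)) - N (x - d) \<le> N (y - e)" if "d \<in> E" "e \<in> E" for d e
      using le[OF subspace_add[OF E that], of "x + y"] sublinear_add[OF N(1), of "x - d" "y - e"]
      by (simp add: algebra_simps)
    then have "(INF e\<in>E. N (x + y - e)) - N (x - d) \<le> (INF e\<in>E. N (y - e))" if "d \<in> E" for d
      using that by (intro cINF_greatest[OF ne]) auto
    then have "(INF e\<in>E. N (x + y - e)) - (INF e\<in>E. N (y - e)) \<le> (INF e\<in>E. N (x - e))"
      by (intro cINF_greatest[OF ne]) (simp add: algebra_simps)
    then show "(INF e\<in>E. N (x + y - e)) \<le> (INF e\<in>E. N (x - e)) + (INF e\<in>E. N (y - e))" by simp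
  next
    fix c :: real and x assume c: "c > 0"
    have "(INF e\<in>E. N (c *\<^sub>R x - e)) / c \<le> N (x - e)" if "e \<in> E" for e
      using le[OF subspace_scale[OF E that, of c], of "c *\<^sub>R x"] sublinear_scale[OF N(1), of c "x - e"] c
      by (simp add: field_simps)
    then have "(INF e\<in>E. N (c *\<^sub>R x - e)) / c \<le> (INF e\<in>E. N (x - e))"
      by (intro cINF_greatest[OF ne])
    then show "(INF e\<in>E. N (c *\<^sub>R x - e)) \<le> c * (INF e\<in>E. N (x - e))"
      using c by (simp add: field_simps)
  qed
qed

text \<open>Hahn--Banach is applied to the gauge modulo \<open>E\<close>. A functional below that
  gauge is at most N(0) = 0 at e and at -e, so it vanishes on \<open>E\<close>, and its value at
  \<open>z\<close> can be chosen to be the distance from \<open>z\<close> to \<open>E\<close>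
  measured by \<open>N\<close>.\<close>

lemma hahn_banach_separation:
  fixes N :: "'a::real_vector \<Rightarrow> real"
  assumes N: "sublinear N" "\<And>x. N x \<ge> 0" and E: "subspace E"
    and d: "\<And>e. e \<in> E \<Longrightarrow> d \<le> N (z - e)"
  obtains F where "linear F" "\<And>x. F x \<le> N x" "\<And>e. e \<in> E \<Longrightarrow> F e = 0" "d \<le> F z"
proof -
  let ?p = "\<lambda>x. INF e\<in>E. N (x - e)"
  obtain F where F: "linear F" "\<And>x. F x \<le> ?p x" "F z = ?p z"
    using hahn_banach[OF sublinear_infimum_modulo[OF N E]] by blast
  have bdd: "bdd_below ((\<lambda>e. N (x - e)) ` E)" for x
    using N(2) by (intro bdd_belowI2[where m = 0]) auto
  have le: "F x \<le> N (x - e)" if "e \<in> E" for x e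
    using F(2)[of x] cINF_lower[OF bdd that, of x] by linarith
  have neg: "F e \<le> 0" if "e \<in> E" for e using le[OF that, of e] sublinear_0[OF N(1)] by simp
  show ?thesis
  proof (rule that[OF F(1)])
    show "F x \<le> N x" for x using le[OF subspace_0[OF E], of x] by simp
    show "F e = 0" if "e \<in> E" for e
      using neg[OF that] neg[OF subspace_neg[OF E that]] linear_neg[OF F(1), of e] by simp
    show "d \<le> F z"
      unfolding F(3) using d subspace_0[OF E] by (intro cINF_greatest) auto
  qed
qed

section \<open>Duality, separability and small slices of the ball\<close>

lemma separable_space_euclidean_iff:
  "separable_space (euclidean :: 'a::topological_space topology)
    \<longleftrightarrow> (\<exists>C::'a set. countable C \<and> closure C = UNIV)"
  by (simp add: separable_space_def)

lemma separable_span: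
  fixes S :: "'a::real_normed_vector set"
  assumes "countable S"
  obtains D where "countable D" "D \<subseteq> span S" "span S \<subseteq> closure D"
proof -
  define R where "R = (\<lambda>(q, s). q *\<^sub>R s) ` (\<rat> \<times> S)"
  \<comment> \<open>Summing over lists makes both requirements immediate: lists over a countable set
    are countable, and concatenation gives closure under addition.\<close>
  define D where "D = sum_list ` lists R"
  have "countable D"
    unfolding D_def R_def using assms countable_rat by (intro countable_image countable_lists) auto
  moreover have "D \<subseteq> span S"
  proof -
    have "sum_list xs \<in> span S" if "xs \<in> lists R" for xs
      using that by (induction xs) (auto simp: R_def intro: span_zero span_add span_scale span_base)
    then show ?thesis by (auto simp: D_def)
  qed
  moreover have "span S \<subseteq> closure D"
  proof
    have 0: "0 \<in> D" unfolding D_def by (rule image_eqI[of _ _ "[]"]) auto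
    have addD: "x + y \<in> D" if "x \<in> D" "y \<in> D" for x y
    proof -
      from that obtain xs ys where "xs \<in> lists R" "ys \<in> lists R" "x = sum_list xs" "y = sum_list ys"
        by (auto simp: D_def)
      then show ?thesis unfolding D_def by (intro image_eqI[of _ _ "xs @ ys"]) auto
    qed
    have add: "x + y \<in> closure D" if x: "x \<in> closure D" and y: "y \<in> closure D" for x y
    proof -
      obtain f where f: "\<And>n. f n \<in> D" "f \<longlonglongrightarrow> x" using x by (auto simp: closure_sequential)
      obtain g where g: "\<And>n. g n \<in> D" "g \<longlonglongrightarrow> y" using y by (auto simp: closure_sequential)
      show ?thesis unfolding closure_sequential
        by (intro exI[of _ "\<lambda>n. f n + g n"] conjI allI addD f g tendsto_add)
    qed
    have scale: "c *\<^sub>R s \<in> closure D" if s: "s \<in> S" for c s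
    proof -
      have "c \<in> closure \<rat>" by (simp add: Rats_closure_real)
      then obtain q where q: "\<And>n. q n \<in> \<rat>" "q \<longlonglongrightarrow> c" by (auto simp: closure_sequential)
      have "q n *\<^sub>R s \<in> D" for n
        unfolding D_def R_def using q(1) s by (intro image_eqI[of _ _ "[q n *\<^sub>R s]"]) auto
      then show ?thesis unfolding closure_sequential
        using q(2) by (intro exI[of _ "\<lambda>n. q n *\<^sub>R s"]) (auto intro: tendsto_intros)
    qed
    fix x assume "x \<in> span S"
    then show "x \<in> closure D"
    proof (induction rule: span_induct_alt)
      case base then show ?case using 0 closure_subset by blast
    next
      case (step c x y) then show ?case by (intro add scale)
    qed
  qed
  ultimately show ?thesis by (rule that)
qed

text \<open>A functional on the dual that norms \<open>f\<close> is evaluation at some x. Testing it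
  on a functional g that norms x yields norm x \<le> 1.\<close>

lemma reflexive_attains_norm:
  fixes f :: "'a::real_normed_vector \<Rightarrow>\<^sub>L real"
  assumes "reflexive_space TYPE('a)"
  obtains x where "norm x \<le> 1" "blinfun_apply f x = norm f"
proof -
  obtain \<Phi> :: "('a \<Rightarrow>\<^sub>L real) \<Rightarrow>\<^sub>L real" where \<Phi>: "norm \<Phi> \<le> 1" "blinfun_apply \<Phi> f = norm f"
    by (rule norming_functional)
  obtain x where x: "\<And>g. blinfun_apply \<Phi> g = blinfun_apply g x"
    using assms unfolding reflexive_space_def by blast
  obtain g :: "'a \<Rightarrow>\<^sub>L real" where g: "norm g \<le> 1" "blinfun_apply g x = norm x"
    by (rule norming_functional)
  have "norm x \<le> norm \<Phi> * norm g" using norm_blinfun[of \<Phi> g] x g by simp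
  also have "\<dots> \<le> 1" using \<Phi>(1) g(1) by (simp add: mult_le_one)
  finally show ?thesis using that \<Phi>(2) x by simp
qed

text \<open>\<open>\<Psi>\<close> restricted to the evaluations defines a functional on the space.
  Every functional on the dual is an evaluation, so this restriction already determines
  \<open>\<Psi>\<close>.\<close>

lemma reflexive_dual:
  assumes "reflexive_space TYPE('a::real_normed_vector)"
  shows "reflexive_space TYPE('a \<Rightarrow>\<^sub>L real)"
  unfolding reflexive_space_def
proof
  fix \<Psi> :: "(('a \<Rightarrow>\<^sub>L real) \<Rightarrow>\<^sub>L real) \<Rightarrow>\<^sub>L real"
  define f :: "'a \<Rightarrow>\<^sub>L real" where "f = Blinfun (\<lambda>x. \<Psi> (blinfun.prod_left x))"
  have "bounded_linear (\<lambda>x::'a. blinfun_apply \<Psi> (blinfun.prod_left x))"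
    by (intro bounded_linear_compose[OF blinfun.bounded_linear_right] blinfun.bounded_linear_prod_left)
  then have f: "blinfun_apply f x = \<Psi> (blinfun.prod_left x)" for x
    unfolding f_def by (simp add: bounded_linear_Blinfun_apply)
  have "blinfun_apply \<Psi> \<Phi> = blinfun_apply \<Phi> f" for \<Phi> :: "('a \<Rightarrow>\<^sub>L real) \<Rightarrow>\<^sub>L real"
  proof -
    obtain x where x: "\<And>g. blinfun_apply \<Phi> g = blinfun_apply g x"
      using assms unfolding reflexive_space_def by blast
    then have "\<Phi> = blinfun.prod_left x"
      by (intro blinfun_eqI) (simp add: blinfun.prod_left.rep_eq)
    with f[of x] x show ?thesis by simp
  qed
  then show "\<exists>f. \<forall>\<Phi>. blinfun_apply \<Psi> \<Phi> = blinfun_apply \<Phi> f" by blast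
qed

text \<open>Functionals norming a countable dense set have dense span. Otherwise a nonzero
  functional on the dual annihilates them all; by reflexivity it is evaluation at some x, and for c
  close to x the norm of c equals \<phi>(c) applied to c - x, hence is small. So x = 0, a
  contradiction.\<close>

lemma separable_dual:
  assumes "reflexive_space TYPE('a::real_normed_vector)"
    and "separable_space (euclidean :: 'a topology)"
  shows "separable_space (euclidean :: ('a \<Rightarrow>\<^sub>L real) topology)"
proof -
  obtain C :: "'a set" where C: "countable C" "closure C = UNIV"
    using assms(2) by (auto simp: separable_space_euclidean_iff)
  have "\<exists>\<phi> :: 'a \<Rightarrow>\<^sub>L real. norm \<phi> \<le> 1 \<and> blinfun_apply \<phi> x = norm x" for x
    using norming_functional by blast
  then obtain \<phi> :: "'a \<Rightarrow> 'a \<Rightarrow>\<^sub>L real"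
    where \<phi>: "\<And>x. norm (\<phi> x) \<le> 1" "\<And>x. blinfun_apply (\<phi> x) x = norm x" by metis
  have dense: "h \<in> closure (span (\<phi> ` C))" for h
  proof (rule ccontr)
    assume "h \<notin> closure (span (\<phi> ` C))"
    then obtain d where d: "d > 0" "\<forall>e\<in>span (\<phi> ` C). \<not> dist e h < d"
      unfolding closure_approachable by blast
    then have dist: "d \<le> norm (h - e)" if "e \<in> span (\<phi> ` C)" for e
      using that by (simp add: dist_norm norm_minus_commute not_less)
    have "sublinear (norm :: ('a \<Rightarrow>\<^sub>L real) \<Rightarrow> real)"
      by (rule sublinearI) (auto simp: norm_triangle_ineq)
    then obtain F where F: "linear F" "\<And>f. F f \<le> norm f" "\<And>e. e \<in> span (\<phi> ` C) \<Longrightarrow> F e = 0" "d \<le> F h"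
      using hahn_banach_separation[of norm "span (\<phi> ` C)" d h] dist by auto
    obtain \<Phi> where \<Phi>: "blinfun_apply \<Phi> = F"
      using blinfun_of_linear_bound[OF F(1), of 1] F(2) by auto
    obtain x where x: "\<And>g. F g = blinfun_apply g x"
      using assms(1) \<Phi> unfolding reflexive_space_def by metis
    have "norm x \<le> e" if e: "e > 0" for e
    proof -
      obtain c where c: "c \<in> C" "dist c x < e / 2"
      proof -
        have "x \<in> closure C" using C(2) by simp
        with half_gt_zero[OF e] show ?thesis using that by (auto simp only: closure_approachable)
      qed
      have "blinfun_apply (\<phi> c) x = 0"
        using F(3)[of "\<phi> c"] c(1) x by (simp add: span_base)
      then have "norm c = blinfun_apply (\<phi> c) (c - x)"
        by (simp add: \<phi>(2) blinfun.diff_right)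
      also have "\<dots> \<le> norm (\<phi> c) * norm (c - x)"
        using norm_blinfun[of "\<phi> c" "c - x"] by simp
      also have "\<dots> \<le> norm (c - x)"
        using \<phi>(1)[of c] by (simp add: mult_left_le_one_le)
      finally show ?thesis
        using c(2) norm_triangle_ineq4[of c "c - x"] by (simp add: dist_norm)
    qed
    then have "x = 0" using field_le_epsilon[of "norm x" 0] by simp
    then show False using F(4) d(1) x[of h] by simp
  qed
  obtain D where D: "countable D" "span (\<phi> ` C) \<subseteq> closure D"
    by (rule separable_span[OF countable_image[OF C(1), of \<phi>]])
  have "closure D = UNIV"
    using dense closure_minimal[OF D(2)] by auto
  with D(1) show ?thesis by (auto simp: separable_space_euclidean_iff)
qed

section \<open>Baire category and small slices\<close>

lemma baire_cball:
  fixes A :: "'i \<Rightarrow> 'a::banach set"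
  assumes "countable I" "\<And>i. i \<in> I \<Longrightarrow> closed (A i)" "cball h r \<subseteq> (\<Union>i\<in>I. A i)" "r > 0"
  obtains i f s where "i \<in> I" "s > 0" "ball f s \<subseteq> A i" "dist h f \<le> r"
proof -
  have "\<exists>i\<in>I. interior (A i \<inter> cball h r) \<noteq> {}"
  proof (rule ccontr)
    assume "\<not> ?thesis"
    then have *: "closed T \<and> interior T = {}" if "T \<in> (\<lambda>i. A i \<inter> cball h r) ` I" for T
      using that assms(2) by (force intro: closed_Int)
    have "interior (\<Union>((\<lambda>i. A i \<inter> cball h r) ` I)) = {}"
      using Met_TC.metric_Baire_category_alt[where 'a='a, of "(\<lambda>i. A i \<inter> cball h r) ` I"] assms(1) *
      by (simp only: mcomplete_iff_complete complete_UNIV closed_closedin[symmetric]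
          mtopology_is_euclidean euclidean_interior_of countable_image simp_thms)
    moreover have "(\<Union>((\<lambda>i. A i \<inter> cball h r) ` I)) = cball h r" using assms(3) by auto
    ultimately show False
      using assms(4) interior_mono[OF ball_subset_cball, of h r]
      by (metis centre_in_ball empty_iff interior_ball subsetD)
  qed
  then obtain i f where i: "i \<in> I" and f: "f \<in> interior (A i \<inter> cball h r)" by blast
  then obtain s where s: "s > 0" "ball f s \<subseteq> A i \<inter> cball h r" by (meson mem_interior)
  with i show ?thesis by (intro that[of i s f]) (auto simp: subset_eq)
qed

text \<open>
  The sets \<open>A c\<close> of functionals that almost attain their norm near \<open>c\<close> are closed and, by
  reflexivity, countably many of them cover the dual.  At an interior point \<open>f\<close> of some \<open>A c\<close>, a far
  away point of the slice would be preferred to all points near \<open>c\<close> by a perturbation of \<open>f\<close>.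
\<close>

lemma small_slice_dense:
  fixes h :: "'a::banach \<Rightarrow>\<^sub>L real"
  assumes refl: "reflexive_space TYPE('a)" and sep: "separable_space (euclidean :: 'a topology)"
    and "\<epsilon> > 0"
  obtains f :: "'a \<Rightarrow>\<^sub>L real" and \<eta> where "norm (f - h) \<le> \<epsilon>" "\<eta> > 0"
    "\<And>y z. norm y \<le> 1 \<Longrightarrow> norm z \<le> 1 \<Longrightarrow> f y > norm f - \<eta> \<Longrightarrow> f z > norm f - \<eta> \<Longrightarrow> norm (y - z) \<le> \<epsilon>"
proof -
  \<comment> \<open>Two points of the slice will lie within \<open>2 * \<rho>\<close> of the same
    \<open>c\<close>, hence within \<open>4 * \<rho>\<close> of each other.\<close>
  define \<rho> where "\<rho> = \<epsilon> / 4"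
  have \<rho>: "\<rho> > 0" using assms by (simp add: \<rho>_def)
  obtain C :: "'a set" where C: "countable C" "closure C = UNIV"
    using sep by (auto simp: separable_space_euclidean_iff)
  define A :: "'a \<Rightarrow> ('a \<Rightarrow>\<^sub>L real) set"
    where "A c = {f. \<forall>e>0. \<exists>z. norm z \<le> 1 \<and> norm (z - c) \<le> \<rho> \<and> blinfun_apply f z > norm f - e}" for c
  have bound: "blinfun_apply f z \<le> norm f" if "norm z \<le> 1" for f :: "'a \<Rightarrow>\<^sub>L real" and z
    using norm_blinfun[of f z] mult_left_mono[OF that norm_ge_zero[of f]] by simp
  have closed: "closed (A c)" for c
    unfolding closed_sequential_limits
  proof (intro allI impI, elim conjE)
    fix F f assume F: "\<forall>n. F n \<in> A c" and lim: "F \<longlonglongrightarrow> f"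
    show "f \<in> A c"
      unfolding A_def
    proof (intro CollectI allI impI)
      fix e :: real assume "e > 0"
      then obtain n where n: "norm (F n - f) < e / 3"
        using LIMSEQ_D[OF lim, of "e / 3"] by auto
      obtain z where z: "norm z \<le> 1" "norm (z - c) \<le> \<rho>" "blinfun_apply (F n) z > norm (F n) - e / 3"
      proof -
        have "e / 3 > 0" "F n \<in> A c" using F \<open>e > 0\<close> by auto
        then show ?thesis using that unfolding A_def by blast
      qed
      have "blinfun_apply (F n) z - blinfun_apply f z \<le> norm (F n - f)"
        using bound[OF z(1), of "F n - f"] by (simp add: blinfun.diff_left)
      moreover have "norm f \<le> norm (F n) + norm (F n - f)"
        using norm_triangle_ineq4[of "F n" "F n - f"] by simp
      ultimately show "\<exists>z. norm z \<le> 1 \<and> norm (z - c) \<le> \<rho> \<and> blinfun_apply f z > norm f - e"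
        using z n by (intro exI[of _ z]) auto
    qed
  qed
  have cover: "\<exists>c\<in>C. f \<in> A c" for f
  proof -
    obtain x where x: "norm x \<le> 1" "blinfun_apply f x = norm f" using reflexive_attains_norm[OF refl] by blast
    obtain c where "c \<in> C" "dist c x < \<rho>" using C(2) \<rho> closure_approachable[of x C] by auto
    then have "c \<in> C" "norm (x - c) \<le> \<rho>" by (auto simp: dist_norm norm_minus_commute)
    moreover have "norm f - e < blinfun_apply f x" if "e > 0" for e using x(2) that by simp
    ultimately show ?thesis using x(1) unfolding A_def by blast
  qed
  obtain c f s where cf: "s > 0" "ball f s \<subseteq> A c" "dist h f \<le> \<epsilon>"
  proof -
    have "cball h \<epsilon> \<subseteq> (\<Union>c\<in>C. A c)" using cover by blast
    then show ?thesis by (rule baire_cball[OF C(1) closed _ \<open>\<epsilon> > 0\<close>]) (rule that)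
  qed
  define t where "t = s / 2"
  have t: "t > 0" "t < s" using cf(1) by (auto simp: t_def)
  \<comment> \<open>A loss of \<open>\<eta>\<close> occurs twice, for \<open>y\<close> in the slice
    of \<open>f\<close> and for \<open>z\<close> nearly attaining the norm of the perturbed
    functional. Together they cost \<open>t * \<rho>\<close>, which, added to the
    \<open>t * \<rho>\<close> coming from the distance of \<open>z\<close> to \<open>c\<close>, just
    reaches the \<open>2 * t * \<rho>\<close> that a far \<open>y\<close> would exceed.\<close>
  define \<eta> where "\<eta> = t * \<rho> / 2"
  have \<eta>: "\<eta> > 0" using t \<rho> by (simp add: \<eta>_def)
  have near: "norm (y - c) \<le> 2 * \<rho>" if y: "norm y \<le> 1" "blinfun_apply f y > norm f - \<eta>" for y
  proof (rule ccontr)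
    assume far: "\<not> ?thesis"
    obtain k :: "'a \<Rightarrow>\<^sub>L real" where k: "norm k \<le> 1" "blinfun_apply k (y - c) = norm (y - c)"
      by (rule norming_functional)
    have "t * norm k \<le> t" using k(1) t by (intro mult_left_le) auto
    moreover have "norm (t *\<^sub>R k) = t * norm k" using t by simp
    ultimately have "norm (t *\<^sub>R k) < s" using t by linarith
    then have "f + t *\<^sub>R k \<in> A c" using cf(2) by (auto simp: dist_norm)
    then obtain z where z: "norm z \<le> 1" "norm (z - c) \<le> \<rho>"
      "blinfun_apply (f + t *\<^sub>R k) z > norm (f + t *\<^sub>R k) - \<eta>"
      unfolding A_def using \<eta> by blast
    have "blinfun_apply f y + t * blinfun_apply k y \<le> norm (f + t *\<^sub>R k)"
      using bound[OF y(1), of "f + t *\<^sub>R k"] by (simp add: blinfun.add_left blinfun.scaleR_left)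
    moreover have "blinfun_apply k (z - c) \<le> \<rho>"
    proof -
      have "blinfun_apply k (z - c) \<le> norm k * norm (z - c)" using norm_blinfun[of k "z - c"] by simp
      also have "\<dots> \<le> 1 * \<rho>" using k z \<rho> by (intro mult_mono) auto
      finally show ?thesis by simp
    qed
    ultimately have "t * (blinfun_apply k y - blinfun_apply k c) < t * \<rho> + 2 * \<eta>"
      using z(3) y(2) bound[OF z(1), of f] mult_left_mono[of "blinfun_apply k (z - c)" \<rho> t] t
      by (simp add: blinfun.add_left blinfun.scaleR_left blinfun.diff_right algebra_simps)
    moreover have "blinfun_apply k y - blinfun_apply k c > 2 * \<rho>"
      using k(2) far by (simp add: blinfun.diff_right)
    then have "t * (blinfun_apply k y - blinfun_apply k c) > t * (2 * \<rho>)"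
      using t(1) by (rule mult_strict_left_mono)
    ultimately show False by (simp add: \<eta>_def mult.commute mult.left_commute)
  qed
  show ?thesis
  proof (rule that[OF _ \<eta>])
    show "norm (f - h) \<le> \<epsilon>" using cf(3) by (simp add: dist_norm norm_minus_commute)
    fix y z assume "norm y \<le> 1" "norm z \<le> 1" "f y > norm f - \<eta>" "f z > norm f - \<eta>"
    then have "norm (y - c) \<le> 2 * \<rho>" "norm (z - c) \<le> 2 * \<rho>" by (auto intro: near)
    then show "norm (y - z) \<le> \<epsilon>"
      using norm_triangle_ineq4[of "y - c" "z - c"] by (simp add: \<rho>_def)
  qed
qed

text \<open>The slice result for the dual yields a functional on the dual, which reflexivity turns
  back into a point \<open>x\<close> of the space. The embedding \<open>J\<close> is isometric, so
  distances and slices carry over.\<close>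

lemma small_dual_slice_dense:
  fixes h :: "'a::banach"
  assumes refl: "reflexive_space TYPE('a)" and sep: "separable_space (euclidean :: 'a topology)"
    and "\<epsilon> > 0"
  obtains x and \<eta> where "norm (x - h) \<le> \<epsilon>" "\<eta> > 0"
    "\<And>f g :: 'a \<Rightarrow>\<^sub>L real. norm f \<le> 1 \<Longrightarrow> norm g \<le> 1 \<Longrightarrow> blinfun_apply f x > norm x - \<eta> \<Longrightarrow> blinfun_apply g x > norm x - \<eta> \<Longrightarrow>
      norm (f - g) \<le> \<epsilon>"
proof -
  define J :: "'a \<Rightarrow> ('a \<Rightarrow>\<^sub>L real) \<Rightarrow>\<^sub>L real" where "J = blinfun.prod_left"
  have J: "blinfun_apply (J x) f = blinfun_apply f x" for x f
    by (simp add: J_def blinfun.prod_left.rep_eq)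
  have norm_J: "norm (J x) = norm x" for x
  proof (rule antisym)
    show "norm (J x) \<le> norm x"
    proof (rule norm_blinfun_bound)
      show "norm (blinfun_apply (J x) f) \<le> norm x * norm f" for f
        using norm_blinfun[of f x] by (simp add: J mult.commute)
    qed simp
    obtain f :: "'a \<Rightarrow>\<^sub>L real" where f: "norm f \<le> 1" "blinfun_apply f x = norm x"
      by (rule norming_functional)
    then show "norm x \<le> norm (J x)"
      using norm_blinfun[of "J x" f] mult_left_mono[OF f(1) norm_ge_zero[of "J x"]] by (simp add: J)
  qed
  obtain \<Phi> \<eta> where \<Phi>: "norm (\<Phi> - J h) \<le> \<epsilon>" "\<eta> > 0"
    "\<And>f g. norm f \<le> 1 \<Longrightarrow> norm g \<le> 1 \<Longrightarrow> blinfun_apply \<Phi> f > norm \<Phi> - \<eta> \<Longrightarrow>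
      blinfun_apply \<Phi> g > norm \<Phi> - \<eta> \<Longrightarrow> norm (f - g) \<le> \<epsilon>"
    by (rule small_slice_dense[OF reflexive_dual[OF refl] separable_dual[OF refl sep] assms(3), of "J h"])
      (rule that)
  obtain x where "\<And>f. blinfun_apply \<Phi> f = blinfun_apply f x"
    using refl unfolding reflexive_space_def by blast
  then have x: "\<Phi> = J x" by (intro blinfun_eqI) (simp add: J)
  have "J x - J h = J (x - h)" by (rule blinfun_eqI) (simp add: J blinfun.diff_left blinfun.diff_right)
  with \<Phi>(1) have "norm (x - h) \<le> \<epsilon>" by (simp add: x norm_J)
  then show ?thesis
    by (rule that[OF _ \<Phi>(2)]) (use \<Phi>(3) in \<open>auto simp: x norm_J J\<close>)
qed

section \<open>Compact operators and two-ball intersections\<close>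

lemma compact_operatorsI:
  assumes "compact C" "blinfun_apply T ` cball 0 1 \<subseteq> C"
  shows "T \<in> compact_operators"
proof -
  have "closure (blinfun_apply T ` cball 0 1) \<subseteq> C"
    using assms by (intro closure_minimal compact_imp_closed)
  then have "closure (blinfun_apply T ` cball 0 1) = C \<inter> closure (blinfun_apply T ` cball 0 1)"
    by blast
  then show ?thesis
    unfolding compact_operators_def using compact_Int_closed[OF assms(1) closed_closure] by (metis mem_Collect_eq)
qed

lemma rank_one_compact: "blinfun_scaleR_left y o\<^sub>L f \<in> compact_operators"
proof (rule compact_operatorsI)
  show "compact ((\<lambda>c. c *\<^sub>R y) ` cball 0 (norm f))"
    by (intro compact_continuous_image continuous_intros compact_cball)
  have "blinfun_apply f x \<in> cball 0 (norm f)" if "norm x \<le> 1" for x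
    using norm_blinfun[of f x] mult_left_mono[OF that norm_ge_zero[of f]] by simp
  then show "blinfun_apply (blinfun_scaleR_left y o\<^sub>L f) ` cball 0 1 \<subseteq> (\<lambda>c. c *\<^sub>R y) ` cball 0 (norm f)"
    by auto
qed

lemma compact_operators_compose_left:
  assumes "K \<in> compact_operators"
  shows "T o\<^sub>L K \<in> compact_operators"
proof (rule compact_operatorsI)
  show "compact (blinfun_apply T ` closure (blinfun_apply K ` cball 0 1))"
    using assms by (intro compact_continuous_image) (auto simp: compact_operators_def intro: continuous_intros)
  show "blinfun_apply (T o\<^sub>L K) ` cball 0 1 \<subseteq> blinfun_apply T ` closure (blinfun_apply K ` cball 0 1)"
    using closure_subset[of "blinfun_apply K ` cball 0 1"] by force
qed

lemma compact_operators_compose_right: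
  fixes T :: "'a::real_normed_vector \<Rightarrow>\<^sub>L 'b::real_normed_vector"
  assumes "K \<in> compact_operators"
  shows "K o\<^sub>L T \<in> compact_operators"
proof (rule compact_operatorsI)
  \<comment> \<open>Adding 1 keeps the scaling factor positive when \<open>T\<close> is
    zero.\<close>
  let ?C = "closure (blinfun_apply K ` cball 0 1)" and ?r = "norm T + 1"
  show "compact ((\<lambda>y. ?r *\<^sub>R y) ` ?C)"
    using assms by (intro compact_scaling) (simp add: compact_operators_def)
  show "blinfun_apply (K o\<^sub>L T) ` cball 0 1 \<subseteq> (\<lambda>y. ?r *\<^sub>R y) ` ?C"
  proof (rule image_subsetI)
    fix x :: 'a assume "x \<in> cball 0 1"
    then have "norm (blinfun_apply T x) \<le> norm T"
      using norm_blinfun[of T x] mult_left_mono[of "norm x" 1 "norm T"] by simp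
    moreover have r: "?r > 0" using norm_ge_zero[of T] by linarith
    ultimately have "norm (blinfun_apply T x /\<^sub>R ?r) \<le> 1" by (simp add: field_simps)
    then have "blinfun_apply K (blinfun_apply T x /\<^sub>R ?r) \<in> ?C"
      using closure_subset[of "blinfun_apply K ` cball 0 1"] by auto
    moreover have "blinfun_apply (K o\<^sub>L T) x = ?r *\<^sub>R blinfun_apply K (blinfun_apply T x /\<^sub>R ?r)"
      using r by (simp add: blinfun.scaleR_right)
    ultimately show "blinfun_apply (K o\<^sub>L T) x \<in> (\<lambda>y. ?r *\<^sub>R y) ` ?C" by blast
  qed
qed

lemma subspace_compact_operators:
  "subspace (compact_operators :: ('a::real_normed_vector \<Rightarrow>\<^sub>L 'b::real_normed_vector) set)"
proof (rule subspaceI)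
  show "(0 :: 'a \<Rightarrow>\<^sub>L 'b) \<in> compact_operators"
    by (rule compact_operatorsI[of "{0}"]) auto
next
  fix S T :: "'a \<Rightarrow>\<^sub>L 'b" assume "S \<in> compact_operators" "T \<in> compact_operators"
  then have "compact {x + y | x y. x \<in> closure (blinfun_apply S ` cball 0 1) \<and> y \<in> closure (blinfun_apply T ` cball 0 1)}"
    by (intro compact_sums) (auto simp: compact_operators_def)
  then show "S + T \<in> compact_operators"
    by (rule compact_operatorsI)
      (use closure_subset[of "blinfun_apply S ` cball 0 1"] closure_subset[of "blinfun_apply T ` cball 0 1"]
        in \<open>fastforce simp: blinfun.add_left\<close>)
next
  fix c :: real and T :: "'a \<Rightarrow>\<^sub>L 'b" assume T: "T \<in> compact_operators"
  have "c *\<^sub>R T = (c *\<^sub>R id_blinfun) o\<^sub>L T" by (rule blinfun_eqI) (simp add: blinfun.scaleR_left)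
  then show "c *\<^sub>R T \<in> compact_operators" using compact_operators_compose_left[OF T] by metis
qed

lemma norm_blinfun_le_unit:
  fixes T :: "'a::real_normed_vector \<Rightarrow>\<^sub>L 'b::real_normed_vector"
  assumes "0 \<le> b" "\<And>x. norm x \<le> 1 \<Longrightarrow> norm (blinfun_apply T x) \<le> b"
  shows "norm T \<le> b"
proof (rule norm_blinfun_bound[OF assms(1)])
  fix x :: 'a
  show "norm (blinfun_apply T x) \<le> b * norm x"
  proof (cases "x = 0")
    case False
    then have "norm (blinfun_apply T (x /\<^sub>R norm x)) \<le> b" by (intro assms(2)) simp
    with False show ?thesis by (simp add: blinfun.scaleR_right field_simps)
  qed simp
qed

text \<open>The common consequence of both hypotheses: ball intersection at \<open>y\<close> for the
  two points 0 and \<open>S\<close>, with \<open>y\<close> allowed to lie in \<open>E\<close>. It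
  will be applied to the identity operator.\<close>

definition two_ball_property :: "'f::real_normed_vector set \<Rightarrow> 'f \<Rightarrow> bool" where
  "two_ball_property E y \<longleftrightarrow> (\<forall>S\<in>E. \<forall>\<epsilon>>0. \<exists>K\<in>E.
     norm (y - K) \<le> norm y + \<epsilon> \<and> norm (y + S - K) \<le> norm (y - S) + \<epsilon>)"

lemma ball_intersection_imp_two_ball:
  assumes "ball_intersection_property E"
  shows "two_ball_property E y"
  unfolding two_ball_property_def
proof (intro ballI allI impI)
  fix S and \<epsilon> :: real assume S: "S \<in> E" and \<epsilon>: "\<epsilon> > 0"
  have E: "subspace E" using assms by (simp add: ball_intersection_property_def)
  show "\<exists>K\<in>E. norm (y - K) \<le> norm y + \<epsilon> \<and> norm (y + S - K) \<le> norm (y - S) + \<epsilon>"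
  proof (cases "y \<in> E")
    \<comment> \<open>The ball intersection property is silent about members of \<open>E\<close>,
      yet in finite dimension the identity is compact. Here \<open>2 *\<^sub>R y\<close> serves as
      the common point, with no error at all.\<close>
    case True
    have "y - 2 *\<^sub>R y = - y" "y + S - 2 *\<^sub>R y = - (y - S)" by (simp_all add: scaleR_2)
    then have "norm (y - 2 *\<^sub>R y) = norm y" "norm (y + S - 2 *\<^sub>R y) = norm (y - S)"
      by (simp_all only: norm_minus_cancel)
    with \<epsilon> subspace_scale[OF E True] show ?thesis by (intro bexI[of _ "2 *\<^sub>R y"]) auto
  next
    case False
    have "finite {0, S} \<and> {0, S} \<subseteq> E \<and> \<epsilon> > 0" using S \<epsilon> subspace_0[OF E] by simp
    with assms False have "E \<inter> (\<Inter>x\<in>{0, S}. cball (y + x) (norm (y - x) + \<epsilon>) \<inter> span (insert y E)) \<noteq> {}"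
      unfolding ball_intersection_property_def by blast
    then show ?thesis by (auto simp: dist_norm)
  qed
qed

lemma norm_functional_le:
  fixes f :: "'a::real_normed_vector \<Rightarrow>\<^sub>L real"
  assumes "\<And>x. norm x \<le> 1 \<Longrightarrow> blinfun_apply f x \<le> b"
  shows "norm f \<le> b"
proof (rule norm_blinfun_bound)
  show "0 \<le> b" using assms[of 0] by simp
  fix x :: 'a
  show "norm (blinfun_apply f x) \<le> b * norm x"
  proof (cases "x = 0")
    case False
    then have "blinfun_apply f (x /\<^sub>R norm x) \<le> b" "blinfun_apply f ((- x) /\<^sub>R norm x) \<le> b"
      by (auto intro!: assms)
    with False show ?thesis
      by (simp add: blinfun.scaleR_right blinfun.minus_right abs_le_iff field_simps)
  qed simp
qed

lemma functional_le:
  fixes f :: "'a::real_normed_vector \<Rightarrow>\<^sub>L real"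
  shows "blinfun_apply f x \<le> norm f * norm x"
  using norm_blinfun[of f x] by simp

text \<open>Write Q = id - 2P. A separating pair (f, g) vanishes on the diagonal, so f + g
  annihilates \<open>E\<close> and Q(f + g) = -(f + g). On the other hand P g vanishes at
  \<open>S\<close>, so Q g and g agree there. Thus Q, of norm 1, trades the point y + S for y - S,
  whose norm controls the second radius.\<close>

lemma u_ideal_imp_two_ball:
  fixes E :: "'f::banach set"
  assumes "u_ideal E"
  shows "two_ball_property E y"
  unfolding two_ball_property_def
proof (intro ballI allI impI)
  fix S and \<epsilon> :: real assume S: "S \<in> E" and \<epsilon>: "\<epsilon> > 0"
  obtain P :: "('f \<Rightarrow>\<^sub>L real) \<Rightarrow>\<^sub>L ('f \<Rightarrow>\<^sub>L real)" where E: "subspace E"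
    and P: "P o\<^sub>L P = P" "range (blinfun_apply P) = annihilator E" "norm (id_blinfun - 2 *\<^sub>R P) = 1"
    using assms unfolding u_ideal_def by blast
  define r s where "r = norm y + \<epsilon>" and "s = norm (y - S) + \<epsilon>"
  have rs: "r > 0" "s > 0" using \<epsilon> by (simp_all add: r_def s_def add_nonneg_pos)
  \<comment> \<open>The gauge of the product of the balls of radii \<open>r\<close> and
    \<open>s\<close> about 0; K lies in both balls around \<open>y\<close> and \<open>y + S\<close>
    exactly when (y, y + S) - (K, K) has gauge at most 1.\<close>
  define N :: "'f \<times> 'f \<Rightarrow> real" where "N z = max (norm (fst z) / r) (norm (snd z) / s)" for z
  have subN: "sublinear N"
  proof (rule sublinearI)
    fix x z :: "'f \<times> 'f"
    have "norm (fst (x + z)) / r \<le> norm (fst x) / r + norm (fst z) / r"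
      using rs norm_triangle_ineq[of "fst x" "fst z"] by (simp add: add_divide_distrib[symmetric] divide_right_mono)
    moreover have "norm (snd (x + z)) / s \<le> norm (snd x) / s + norm (snd z) / s"
      using rs norm_triangle_ineq[of "snd x" "snd z"] by (simp add: add_divide_distrib[symmetric] divide_right_mono)
    ultimately show "N (x + z) \<le> N x + N z" unfolding N_def by linarith
  next
    fix c :: real and x :: "'f \<times> 'f" assume "c > 0"
    then show "N (c *\<^sub>R x) \<le> c * N x" unfolding N_def by (simp add: max_mult_distrib_left)
  qed
  have N0: "N z \<ge> 0" for z unfolding N_def using rs by (simp add: le_max_iff_disj)
  have diag: "subspace ((\<lambda>e. (e, e)) ` E)"
    using E unfolding subspace_def by (auto simp: image_iff zero_prod_def)
  show "\<exists>K\<in>E. norm (y - K) \<le> norm y + \<epsilon> \<and> norm (y + S - K) \<le> norm (y - S) + \<epsilon>"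
  proof (rule ccontr)
    assume "\<not> ?thesis"
    then have far: "norm (y - K) > r \<or> norm (y + S - K) > s" if "K \<in> E" for K
      using that by (force simp: r_def s_def)
    have sep: "1 \<le> N ((y, y + S) - e)" if e: "e \<in> (\<lambda>e. (e, e)) ` E" for e
      using e far rs unfolding N_def by (fastforce simp: field_simps le_max_iff_disj)
    obtain F where F: "linear F" "\<And>z. F z \<le> N z" "\<And>e. e \<in> (\<lambda>e. (e, e)) ` E \<Longrightarrow> F e = 0"
      "1 \<le> F (y, y + S)"
      by (rule hahn_banach_separation[OF subN N0 diag sep], assumption, rule that)
    have "linear (\<lambda>u::'f. (u, 0::'f))" "linear (\<lambda>v::'f. (0::'f, v))"
      by (auto intro!: linearI)
    then have l1: "linear (\<lambda>u. F (u, 0))" and l2: "linear (\<lambda>v. F (0, v))"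
      using linear_compose[OF _ F(1), of "\<lambda>u. (u, 0)"] linear_compose[OF _ F(1), of "\<lambda>v. (0, v)"]
      by (simp_all add: o_def)
    have F1: "F (u, 0) \<le> (1 / r) * norm u" for u
      using F(2)[of "(u, 0)"] rs by (simp add: N_def max_absorb1)
    obtain f :: "'f \<Rightarrow>\<^sub>L real" where f: "blinfun_apply f = (\<lambda>u. F (u, 0))"
      by (rule blinfun_of_linear_bound[OF l1 F1]) (use rs in auto)
    have F2: "F (0, v) \<le> (1 / s) * norm v" for v
      using F(2)[of "(0, v)"] rs by (simp add: N_def max_absorb2)
    obtain g :: "'f \<Rightarrow>\<^sub>L real" where g: "blinfun_apply g = (\<lambda>v. F (0, v))"
      by (rule blinfun_of_linear_bound[OF l2 F2]) (use rs in auto)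
    have Ffg: "F (u, v) = blinfun_apply f u + blinfun_apply g v" for u v
      using linear_add[OF F(1), of "(u, 0)" "(0, v)"] f g by simp
    \<comment> \<open>Optimizing over \<open>u\<close> and over \<open>v\<close> separately turns
      this bound into the dual norm estimate \<open>r * norm f + s * norm g \<le> 1\<close>.\<close>
    have b1: "r * blinfun_apply f u + s * blinfun_apply g v \<le> 1" if "norm u \<le> 1" "norm v \<le> 1" for u v
    proof -
      have "F (r *\<^sub>R u, s *\<^sub>R v) \<le> 1"
        using F(2)[of "(r *\<^sub>R u, s *\<^sub>R v)"] that rs by (simp add: N_def)
      then show ?thesis by (simp add: Ffg blinfun.scaleR_right)
    qed
    have "norm f \<le> (1 - s * blinfun_apply g v) / r" if "norm v \<le> 1" for v
      using b1[OF _ that] rs by (intro norm_functional_le) (simp add: field_simps)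
    then have "norm g \<le> (1 - r * norm f) / s"
      using rs by (intro norm_functional_le) (simp add: field_simps)
    then have norms: "r * norm f + s * norm g \<le> 1" using rs by (simp add: field_simps)
    \<comment> \<open>Hence \<open>P\<close> fixes \<open>f + g\<close>, which turns \<open>F (y, y + S)\<close> into values of \<open>2P - id\<close>.\<close>
    have "f + g \<in> annihilator E"
      using F(3) by (auto simp: annihilator_def blinfun.add_left Ffg[symmetric])
    then obtain \<psi> where "f + g = blinfun_apply P \<psi>" using P(2) by blast
    then have "blinfun_apply P (f + g) = f + g"
      using P(1) blinfun_apply_blinfun_compose[of P P \<psi>] by simp
    then have Pfg: "blinfun_apply (P f) y + blinfun_apply (P g) y = blinfun_apply f y + blinfun_apply g y"
      by (metis blinfun.add_left blinfun.add_right)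
    have PgS: "blinfun_apply (P g) S = 0"
    proof -
      have "blinfun_apply P g \<in> annihilator E" using P(2) by blast
      then show ?thesis using S by (simp add: annihilator_def)
    qed
    define Q where "Q = id_blinfun - 2 *\<^sub>R P"
    have Q: "blinfun_apply (Q \<phi>) u = blinfun_apply \<phi> u - 2 * blinfun_apply (P \<phi>) u" for \<phi> u
      by (simp add: Q_def blinfun.diff_left blinfun.scaleR_left)
    have Qle: "- blinfun_apply (Q \<phi>) u \<le> norm \<phi> * norm u" for \<phi> u
    proof -
      have "- blinfun_apply (Q \<phi>) u \<le> norm (Q \<phi>) * norm u"
        using norm_blinfun[of "Q \<phi>" u] by simp
      also have "\<dots> \<le> norm \<phi> * norm u"
        using norm_blinfun[of Q \<phi>] P(3) by (intro mult_right_mono) (auto simp: Q_def)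
      finally show ?thesis .
    qed
    have "F (y, y + S) = - blinfun_apply (Q f) y - blinfun_apply (Q g) (y - S)"
      unfolding Ffg Q using Pfg PgS by (simp add: blinfun.add_right blinfun.diff_right)
    also have "\<dots> \<le> norm f * norm y + norm g * norm (y - S)"
      using Qle[of f y] Qle[of g "y - S"] by linarith
    also have "\<dots> = (r * norm f + s * norm g) - \<epsilon> * (norm f + norm g)"
      by (simp add: r_def s_def algebra_simps)
    \<comment> \<open>The slack \<epsilon> in both radii is what contradicts the separation: the
      left end of the chain is at least 1, the bracket at most 1, so both functionals
      vanish.\<close>
    finally have "\<epsilon> * (norm f + norm g) \<le> 0" using norms F(4) by linarith
    then have "norm f + norm g \<le> 0" using \<epsilon> by (simp add: mult_le_0_iff)
    then have "norm f = 0" "norm g = 0" using norm_ge_zero[of f] norm_ge_zero[of g] by linarith+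
    then have "F (y, y + S) = 0" by (simp add: Ffg)
    with F(4) show False by simp
  qed
qed

section \<open>Unconditional compact approximation of the identity\<close>

text \<open>Apply f to (id + S - K) x. The result is c + t c^2 - f(K x), and it is at most (tc - 1 +
  2e) c. The terms t c^2 cancel, so the bound does not depend on t, however large it has to
  be.\<close>

lemma two_ball_functional_bound:
  fixes f :: "'a::real_normed_vector \<Rightarrow>\<^sub>L real"
  assumes "two_ball_property (compact_operators :: ('a \<Rightarrow>\<^sub>L 'a) set) id_blinfun"
    and e: "e > 0"
    and S: "norm (t *\<^sub>R (blinfun_scaleR_left x o\<^sub>L f) - id_blinfun) \<le> t * c - 1 + e"
    and x: "blinfun_apply f x = c" "norm f * norm x = c"
  obtains K :: "'a \<Rightarrow>\<^sub>L 'a" where "K \<in> compact_operators" "norm (id_blinfun - K) \<le> 1 + e"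
    "norm K \<le> 2 + e" "blinfun_apply f (K x) \<ge> 2 * c - 2 * e * c"
proof -
  define S where "S = t *\<^sub>R (blinfun_scaleR_left x o\<^sub>L f)"
  have "S \<in> compact_operators"
    unfolding S_def by (intro subspace_scale[OF subspace_compact_operators] rank_one_compact)
  then obtain K where K: "K \<in> compact_operators" "norm (id_blinfun - K) \<le> norm (id_blinfun :: 'a \<Rightarrow>\<^sub>L 'a) + e"
    "norm (id_blinfun + S - K) \<le> norm (id_blinfun - S) + e"
    using assms(1) e unfolding two_ball_property_def by blast
  have id: "norm (id_blinfun :: 'a \<Rightarrow>\<^sub>L 'a) \<le> 1" by (rule norm_blinfun_id_le)
  have c: "c \<ge> 0" using x(2) by auto
  have "norm (id_blinfun + S - K) \<le> t * c - 1 + 2 * e"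
    using K(3) S by (simp add: S_def norm_minus_commute)
  moreover have "blinfun_apply f ((id_blinfun + S - K) x) \<le> norm (id_blinfun + S - K) * c"
  proof -
    have "blinfun_apply f ((id_blinfun + S - K) x) \<le> norm f * norm ((id_blinfun + S - K) x)"
      by (rule functional_le)
    also have "\<dots> \<le> norm f * (norm (id_blinfun + S - K) * norm x)"
      by (intro mult_left_mono norm_blinfun) auto
    also have "\<dots> = norm (id_blinfun + S - K) * c" by (simp add: x(2)[symmetric] ac_simps)
    finally show ?thesis .
  qed
  ultimately have "blinfun_apply f ((id_blinfun + S - K) x) \<le> (t * c - 1 + 2 * e) * c"
    using mult_right_mono[OF _ c] order_trans by blast
  moreover have "blinfun_apply f ((id_blinfun + S - K) x) = c + t * c * c - blinfun_apply f (K x)"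
    using x(1) by (simp add: S_def blinfun.add_left blinfun.diff_left blinfun.scaleR_left
        blinfun.add_right blinfun.diff_right blinfun.scaleR_right)
  ultimately have *: "blinfun_apply f (K x) \<ge> 2 * c - 2 * e * c" by (simp add: algebra_simps)
  have "norm K \<le> norm (id_blinfun :: 'a \<Rightarrow>\<^sub>L 'a) + norm (id_blinfun - K)"
    using norm_triangle_ineq4[of id_blinfun "id_blinfun - K"] by simp
  with K(2) id show ?thesis using that[OF K(1) _ _ *] by linarith
qed

text \<open>Serves the degenerate case in which the perturbed functional or vector is zero. The
  given one is then so small that only the distance to the identity has content.\<close>

lemma two_ball_near_id:
  fixes E :: "('a::real_normed_vector \<Rightarrow>\<^sub>L 'a) set"
  assumes "two_ball_property E id_blinfun" "0 \<in> E" "e > 0"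
  obtains K where "K \<in> E" "norm (id_blinfun - K) \<le> 1 + e"
proof -
  obtain K where K: "K \<in> E" "norm (id_blinfun - K) \<le> norm (id_blinfun :: 'a \<Rightarrow>\<^sub>L 'a) + e"
    using assms unfolding two_ball_property_def by blast
  have "norm (id_blinfun :: 'a \<Rightarrow>\<^sub>L 'a) \<le> 1" by (rule norm_blinfun_id_le)
  with K show ?thesis using that by force
qed

text \<open>Accounts for the factor 7 + 2n: replacing c by n costs 2e, the term 2ec costs 2en + 2e^2
  \<le> 2en + 2e, and (2 + e)e costs at most 3e. The last term is the price of returning from the
  perturbed functional or vector to the given one.\<close>

lemma perturbation_estimate:
  fixes c e n v \<epsilon> :: real
  assumes "n - e \<le> c" "c \<le> n + e" "e \<le> 1" "e > 0" "e * (7 + 2 * n) \<le> \<epsilon>"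
    "v \<ge> 2 * c - 2 * e * c - (2 + e) * e"
  shows "v \<ge> 2 * n - \<epsilon>"
proof -
  have "e * c \<le> e * (n + e)" "e * e \<le> e * 1" using assms by (auto intro!: mult_left_mono)
  then have "e * c \<le> e * n + e * e" "e * e \<le> e" by (simp_all only: distrib_left mult_1_right)
  moreover have "e * 7 + 2 * (e * n) \<le> \<epsilon>" "v \<ge> 2 * c - 2 * (e * c) - 2 * e - e * e"
    using assms(5,6) by (simp_all add: algebra_simps)
  ultimately show ?thesis using assms(1) by linarith
qed

text \<open>The equation t \<eta>' = 2 turns the crude bound t(c - \<eta>') + 1 outside the slice
  into tc - 1. The last inequality keeps the coefficient t f(w) - 1 nonnegative inside the
  slice.\<close>

lemma large_multiple:
  fixes c \<eta> :: real
  assumes "c > 0" "\<eta> > 0"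
  obtains t \<eta>' where "t > 0" "\<eta>' \<le> \<eta>" "t * \<eta>' = 2" "t * (c - \<eta>') \<ge> 1"
proof -
  define \<eta>' where "\<eta>' = min \<eta> (c / 2)"
  have *: "\<eta>' > 0" "\<eta>' \<le> \<eta>" "2 * \<eta>' \<le> c" using assms by (auto simp: \<eta>'_def)
  show ?thesis
    by (rule that[of "2 / \<eta>'" \<eta>']) (use * in \<open>auto simp: field_simps\<close>)
qed

text \<open>In the slice, w is close to x, so t f(w) x - w is nearly (t f(w) - 1) x, of norm at most
  tc - 1. Where f is at most c - \<eta>' in absolute value, the triangle inequality suffices;
  negative values reduce to positive ones by replacing w with -w.\<close>

lemma compact_approximation_domain:
  fixes h :: "'a::banach \<Rightarrow>\<^sub>L real"
  assumes refl: "reflexive_space TYPE('a)" and sep: "separable_space (euclidean :: 'a topology)"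
    and two: "two_ball_property (compact_operators :: ('a \<Rightarrow>\<^sub>L 'a) set) id_blinfun"
    and \<epsilon>: "\<epsilon> > 0"
  obtains K where "K \<in> compact_operators" "norm (id_blinfun - K) \<le> 1 + \<epsilon>"
    "norm (h o\<^sub>L K) \<ge> 2 * norm h - \<epsilon>"
proof -
  define e where "e = min 1 (\<epsilon> / (7 + 2 * norm h))"
  have pos: "7 + 2 * norm h > 0" using norm_ge_zero[of h] by linarith
  have e: "e > 0" "e \<le> 1" using \<epsilon> pos by (auto simp: e_def)
  have "e \<le> \<epsilon> / (7 + 2 * norm h)" by (simp add: e_def)
  then have e_le: "e * (7 + 2 * norm h) \<le> \<epsilon>" using pos by (simp add: pos_le_divide_eq)
  have "e * 7 \<le> e * (7 + 2 * norm h)" using e(1) by (intro mult_left_mono) auto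
  then have e7: "e * 7 \<le> \<epsilon>" using e_le by linarith
  obtain f \<eta> where f: "norm (f - h) \<le> e" "\<eta> > 0"
    "\<And>y z. norm y \<le> 1 \<Longrightarrow> norm z \<le> 1 \<Longrightarrow> blinfun_apply f y > norm f - \<eta> \<Longrightarrow>
      blinfun_apply f z > norm f - \<eta> \<Longrightarrow> norm (y - z) \<le> e"
    by (rule small_slice_dense[OF refl sep e(1), of h]) (rule that)
  define c where "c = norm f"
  have c: "norm h - e \<le> c" "c \<le> norm h + e"
    using norm_triangle_ineq2[of f h] norm_triangle_ineq2[of h f] f(1) unfolding c_def
    by (simp_all add: norm_minus_commute)
  show ?thesis
  proof (cases "c = 0")
    case True
    obtain K :: "'a \<Rightarrow>\<^sub>L 'a" where "K \<in> compact_operators" "norm (id_blinfun - K) \<le> 1 + e"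
      by (rule two_ball_near_id[OF two subspace_0[OF subspace_compact_operators] e(1)])
    moreover have "2 * norm h - \<epsilon> \<le> norm (h o\<^sub>L K)"
      using True c e7 e(1) norm_ge_zero[of "h o\<^sub>L K"] by linarith
    ultimately show ?thesis using that[of K] e7 e(1) by linarith
  next
    case False
    then have "c > 0" by (simp add: c_def)
    then obtain t \<eta>' where t: "t > 0" "\<eta>' \<le> \<eta>" "t * \<eta>' = 2" "t * (c - \<eta>') \<ge> 1"
      using large_multiple[OF _ f(2)] by blast
    obtain x where x: "norm x \<le> 1" "blinfun_apply f x = c"
      unfolding c_def using reflexive_attains_norm[OF refl] by blast
    have slice: "norm (t *\<^sub>R blinfun_apply f w *\<^sub>R x - w) \<le> t * c - 1 + e"
      if w: "norm w \<le> 1" "blinfun_apply f w > c - \<eta>'" for w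
    proof -
      have fw: "blinfun_apply f w \<le> c"
        using functional_le[of f w] mult_left_mono[OF w(1) norm_ge_zero[of f]] by (simp add: c_def)
      have "norm (x - w) \<le> e"
        using f(3)[OF x(1) w(1)] f(2) w(2) x(2) t(2) by (simp add: c_def)
      have ge: "t * blinfun_apply f w \<ge> 1"
        using t(1,4) mult_left_mono[of "c - \<eta>'" "blinfun_apply f w" t] w(2) by linarith
      have "t *\<^sub>R blinfun_apply f w *\<^sub>R x - w = (t * blinfun_apply f w - 1) *\<^sub>R x + (x - w)"
        by (simp add: algebra_simps)
      also have "norm \<dots> \<le> (t * blinfun_apply f w - 1) * norm x + norm (x - w)"
        using norm_triangle_ineq[of "(t * blinfun_apply f w - 1) *\<^sub>R x" "x - w"] ge by simp
      also have "\<dots> \<le> (t * blinfun_apply f w - 1) * 1 + e"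
        using x(1) ge \<open>norm (x - w) \<le> e\<close> by (intro add_mono mult_left_mono) auto
      also have "\<dots> \<le> t * c - 1 + e" using fw t(1) by simp
      finally show ?thesis .
    qed
    have S: "norm (t *\<^sub>R (blinfun_scaleR_left x o\<^sub>L f) - id_blinfun) \<le> t * c - 1 + e"
    proof (rule norm_blinfun_le_unit)
      show "0 \<le> t * c - 1 + e" using t(3,4) e(1) by (simp add: algebra_simps)
      fix w :: 'a assume w: "norm w \<le> 1"
      consider "blinfun_apply f w > c - \<eta>'" | "blinfun_apply f (- w) > c - \<eta>'"
        | "\<bar>blinfun_apply f w\<bar> \<le> c - \<eta>'" by (force simp: blinfun.minus_right)
      then have "norm (t *\<^sub>R blinfun_apply f w *\<^sub>R x - w) \<le> t * c - 1 + e"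
      proof cases
        case 1 then show ?thesis using slice w by blast
      next
        case 2
        have "norm (t *\<^sub>R blinfun_apply f w *\<^sub>R x - w) = norm (t *\<^sub>R blinfun_apply f (- w) *\<^sub>R x - (- w))"
          by (subst norm_minus_cancel[symmetric]) (simp add: blinfun.minus_right)
        then show ?thesis using slice[of "- w"] 2 w by simp
      next
        case 3
        have "norm (t *\<^sub>R blinfun_apply f w *\<^sub>R x - w) \<le> t * \<bar>blinfun_apply f w\<bar> * norm x + norm w"
          using norm_triangle_ineq4[of "t *\<^sub>R blinfun_apply f w *\<^sub>R x" w] t(1) by (simp add: abs_mult mult.assoc)
        also have "\<dots> \<le> t * (c - \<eta>') * 1 + 1"
          using 3 t(1) x(1) w by (intro add_mono mult_mono) auto
        also have "\<dots> = t * c - 1" using t(3) by (simp add: algebra_simps)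
        finally show ?thesis using e(1) by simp
      qed
      then show "norm (blinfun_apply (t *\<^sub>R (blinfun_scaleR_left x o\<^sub>L f) - id_blinfun) w) \<le> t * c - 1 + e"
        by (simp add: blinfun.diff_left blinfun.scaleR_left)
    qed
    have "c \<le> c * norm x" using functional_le[of f x] x(2) by (simp add: c_def)
    then have "norm f * norm x = c" using x(1) mult_left_mono[OF x(1), of c] by (simp add: c_def)
    then obtain K where K: "K \<in> compact_operators" "norm (id_blinfun - K) \<le> 1 + e"
      "norm K \<le> 2 + e" "blinfun_apply f (K x) \<ge> 2 * c - 2 * e * c"
      using two_ball_functional_bound[OF two e(1) S x(2)] by blast
    have "norm (K x) \<le> 2 + e"
      using norm_blinfun[of K x] mult_left_mono[OF x(1) norm_ge_zero[of K]] K(3) by simp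
    then have "norm (f - h) * norm (K x) \<le> e * (2 + e)"
      using f(1) e(1) by (intro mult_mono) auto
    then have "blinfun_apply (f - h) (K x) \<le> (2 + e) * e"
      using functional_le[of "f - h" "K x"] by (simp add: mult.commute)
    moreover have "blinfun_apply h (K x) \<le> norm (h o\<^sub>L K)"
      using functional_le[of "h o\<^sub>L K" x] mult_left_mono[OF x(1) norm_ge_zero[of "h o\<^sub>L K"]] by simp
    ultimately have "norm (h o\<^sub>L K) \<ge> 2 * c - 2 * e * c - (2 + e) * e"
      using K(4) by (simp add: blinfun.diff_left)
    then have "norm (h o\<^sub>L K) \<ge> 2 * norm h - \<epsilon>" using perturbation_estimate[OF c e(2,1) e_le] by blast
    with K(1,2) e7 e(1) show ?thesis using that[of K] by linarith
  qed
qed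

text \<open>The dual form of the preceding argument: the point x now cuts out the slice and g is a
  functional norming it. The norm of t g(w) x - w is tested by functionals k; if k(x) is close to c,
  then k is close to g, and the value is nearly (t k(x) - 1) g(w).\<close>

lemma compact_approximation_codomain:
  fixes h :: "'a::banach"
  assumes refl: "reflexive_space TYPE('a)" and sep: "separable_space (euclidean :: 'a topology)"
    and two: "two_ball_property (compact_operators :: ('a \<Rightarrow>\<^sub>L 'a) set) id_blinfun"
    and \<epsilon>: "\<epsilon> > 0"
  obtains K :: "'a \<Rightarrow>\<^sub>L 'a" where "K \<in> compact_operators" "norm (id_blinfun - K) \<le> 1 + \<epsilon>"
    "norm (K h) \<ge> 2 * norm h - \<epsilon>"
proof -
  define e where "e = min 1 (\<epsilon> / (7 + 2 * norm h))"
  have pos: "7 + 2 * norm h > 0" using norm_ge_zero[of h] by linarith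
  have e: "e > 0" "e \<le> 1" using \<epsilon> pos by (auto simp: e_def)
  have "e \<le> \<epsilon> / (7 + 2 * norm h)" by (simp add: e_def)
  then have e_le: "e * (7 + 2 * norm h) \<le> \<epsilon>" using pos by (simp add: pos_le_divide_eq)
  have "e * 7 \<le> e * (7 + 2 * norm h)" using e(1) by (intro mult_left_mono) auto
  then have e7: "e * 7 \<le> \<epsilon>" using e_le by linarith
  obtain x \<eta> where f: "norm (x - h) \<le> e" "\<eta> > 0"
    "\<And>y z :: 'a \<Rightarrow>\<^sub>L real. norm y \<le> 1 \<Longrightarrow> norm z \<le> 1 \<Longrightarrow> blinfun_apply y x > norm x - \<eta> \<Longrightarrow>
      blinfun_apply z x > norm x - \<eta> \<Longrightarrow> norm (y - z) \<le> e"
    by (rule small_dual_slice_dense[OF refl sep e(1), of h]) (rule that)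
  define c where "c = norm x"
  have c: "norm h - e \<le> c" "c \<le> norm h + e"
    using norm_triangle_ineq2[of x h] norm_triangle_ineq2[of h x] f(1) unfolding c_def
    by (simp_all add: norm_minus_commute)
  show ?thesis
  proof (cases "c = 0")
    case True
    obtain K :: "'a \<Rightarrow>\<^sub>L 'a" where "K \<in> compact_operators" "norm (id_blinfun - K) \<le> 1 + e"
      by (rule two_ball_near_id[OF two subspace_0[OF subspace_compact_operators] e(1)])
    moreover have "2 * norm h - \<epsilon> \<le> norm (K h)"
      using True c e7 e(1) norm_ge_zero[of "K h"] by linarith
    ultimately show ?thesis using that[of K] e7 e(1) by linarith
  next
    case False
    then have "c > 0" by (simp add: c_def)
    then obtain t \<eta>' where t: "t > 0" "\<eta>' \<le> \<eta>" "t * \<eta>' = 2" "t * (c - \<eta>') \<ge> 1"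
      using large_multiple[OF _ f(2)] by blast
    obtain g :: "'a \<Rightarrow>\<^sub>L real" where g: "norm g \<le> 1" "blinfun_apply g x = c"
      unfolding c_def by (rule norming_functional)
    have slice: "\<bar>t * blinfun_apply g w * blinfun_apply k x - blinfun_apply k w\<bar> \<le> t * c - 1 + e"
      if w: "norm w \<le> 1" and k: "norm k \<le> 1" "blinfun_apply k x > c - \<eta>'" for w k
    proof -
      have kx: "blinfun_apply k x \<le> c"
        using functional_le[of k x] mult_right_mono[OF k(1) norm_ge_zero[of x]] by (simp add: c_def)
      have "norm (g - k) \<le> e"
        using f(3)[OF g(1) k(1)] f(2) g(2) k(2) t(2) by (simp add: c_def)
      then have gk: "\<bar>blinfun_apply (g - k) w\<bar> \<le> e"
        using norm_blinfun[of "g - k" w] mult_left_mono[OF w norm_ge_zero[of "g - k"]] by simp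
      have gw: "\<bar>blinfun_apply g w\<bar> \<le> 1"
        using norm_blinfun[of g w] mult_mono[OF g(1) w] by simp
      have ge: "t * blinfun_apply k x \<ge> 1"
        using t(1,4) mult_left_mono[of "c - \<eta>'" "blinfun_apply k x" t] k(2) by linarith
      have "t * blinfun_apply g w * blinfun_apply k x - blinfun_apply k w
          = (t * blinfun_apply k x - 1) * blinfun_apply g w + blinfun_apply (g - k) w"
        by (simp add: algebra_simps blinfun.diff_left)
      also have "\<bar>\<dots>\<bar> \<le> (t * blinfun_apply k x - 1) * \<bar>blinfun_apply g w\<bar> + \<bar>blinfun_apply (g - k) w\<bar>"
        using abs_triangle_ineq[of "(t * blinfun_apply k x - 1) * blinfun_apply g w"] ge
        by (simp add: abs_mult)
      also have "\<dots> \<le> (t * blinfun_apply k x - 1) * 1 + e"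
        using gw gk ge by (intro add_mono mult_left_mono) auto
      also have "\<dots> \<le> t * c - 1 + e" using kx t(1) by simp
      finally show ?thesis .
    qed
    have S: "norm (t *\<^sub>R (blinfun_scaleR_left x o\<^sub>L g) - id_blinfun) \<le> t * c - 1 + e"
    proof (rule norm_blinfun_le_unit)
      show "0 \<le> t * c - 1 + e" using t(3,4) e(1) by (simp add: algebra_simps)
      fix w :: 'a assume w: "norm w \<le> 1"
      obtain k :: "'a \<Rightarrow>\<^sub>L real" where k: "norm k \<le> 1"
        "blinfun_apply k (t *\<^sub>R blinfun_apply g w *\<^sub>R x - w) = norm (t *\<^sub>R blinfun_apply g w *\<^sub>R x - w)"
        by (rule norming_functional)
      consider "blinfun_apply k x > c - \<eta>'" | "blinfun_apply (- k) x > c - \<eta>'"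
        | "\<bar>blinfun_apply k x\<bar> \<le> c - \<eta>'" by (force simp: blinfun.minus_left)
      then have "\<bar>t * blinfun_apply g w * blinfun_apply k x - blinfun_apply k w\<bar> \<le> t * c - 1 + e"
      proof cases
        case 1 then show ?thesis using slice w k by blast
      next
        case 2
        have "\<bar>t * blinfun_apply g w * blinfun_apply k x - blinfun_apply k w\<bar>
            = \<bar>t * blinfun_apply g w * blinfun_apply (- k) x - blinfun_apply (- k) w\<bar>"
          by (subst abs_minus_cancel[symmetric]) (simp add: blinfun.minus_left)
        then show ?thesis using slice[of w "- k"] 2 w k by simp
      next
        case 3
        have gw: "\<bar>blinfun_apply g w\<bar> \<le> 1"
          using norm_blinfun[of g w] mult_mono[OF g(1) w] by simp
        have kw: "\<bar>blinfun_apply k w\<bar> \<le> 1"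
          using norm_blinfun[of k w] mult_mono[OF k(1) w] by simp
        have "\<bar>t * blinfun_apply g w * blinfun_apply k x - blinfun_apply k w\<bar>
            \<le> t * \<bar>blinfun_apply g w\<bar> * \<bar>blinfun_apply k x\<bar> + \<bar>blinfun_apply k w\<bar>"
          using abs_triangle_ineq4[of "t * blinfun_apply g w * blinfun_apply k x" "blinfun_apply k w"] t(1)
          by (simp add: abs_mult)
        also have "\<dots> \<le> t * 1 * (c - \<eta>') + 1"
          using 3 t(1) gw kw by (intro add_mono mult_mono) auto
        also have "\<dots> = t * c - 1" using t(3) by (simp add: algebra_simps)
        finally show ?thesis using e(1) by simp
      qed
      then have "norm (t *\<^sub>R blinfun_apply g w *\<^sub>R x - w) \<le> t * c - 1 + e"
        unfolding k(2)[symmetric] by (simp add: blinfun.diff_right blinfun.scaleR_right mult.assoc)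
      then show "norm (blinfun_apply (t *\<^sub>R (blinfun_scaleR_left x o\<^sub>L g) - id_blinfun) w) \<le> t * c - 1 + e"
        by (simp add: blinfun.diff_left blinfun.scaleR_left)
    qed
    have "c \<le> norm g * c" using functional_le[of g x] g(2) by (simp add: c_def)
    then have "norm g * norm x = c"
      using g(1) mult_right_mono[OF g(1), of c] by (simp add: c_def)
    then obtain K :: "'a \<Rightarrow>\<^sub>L 'a" where K: "K \<in> compact_operators" "norm (id_blinfun - K) \<le> 1 + e"
      "norm K \<le> 2 + e" "blinfun_apply g (K x) \<ge> 2 * c - 2 * e * c"
      using two_ball_functional_bound[OF two e(1) S g(2)] by blast
    have "blinfun_apply g (K x) \<le> norm (K x)"
      using functional_le[of g "K x"] mult_right_mono[OF g(1) norm_ge_zero[of "K x"]] by simp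
    moreover have "norm (K x) \<le> norm (K h) + norm (K (x - h))"
      using norm_triangle_ineq[of "K h" "K (x - h)"] by (simp add: blinfun.diff_right)
    moreover have "norm (K (x - h)) \<le> (2 + e) * e"
    proof -
      have "norm (K (x - h)) \<le> norm K * norm (x - h)" by (rule norm_blinfun)
      also have "\<dots> \<le> (2 + e) * e" using K(3) f(1) e(1) by (intro mult_mono) auto
      finally show ?thesis .
    qed
    ultimately have "norm (K h) \<ge> 2 * c - 2 * e * c - (2 + e) * e"
      using K(4) by linarith
    then have "norm (K h) \<ge> 2 * norm h - \<epsilon>" using perturbation_estimate[OF c e(2,1) e_le] by blast
    with K(1,2) e7 e(1) show ?thesis using that[of K] by linarith
  qed
qed

section \<open>Covering the unit sphere\<close>

lemma norm_almost_attained: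
  fixes T :: "'a::real_normed_vector \<Rightarrow>\<^sub>L 'b::real_normed_vector"
  assumes "\<epsilon> > 0"
  obtains x where "norm x \<le> 1" "norm T - \<epsilon> \<le> norm (T x)"
proof (cases "norm T \<le> \<epsilon>")
  case True
  then show ?thesis using that[of 0] by simp
next
  case False
  then have "\<not> (\<forall>x. norm x \<le> 1 \<longrightarrow> norm (blinfun_apply T x) \<le> norm T - \<epsilon>)"
    using norm_blinfun_le_unit[of "norm T - \<epsilon>" T] assms by auto
  then show ?thesis using that by force
qed

text \<open>A functional g norming T x, where T almost attains its norm, reduces the operator to the
  functional g o T. Its norm falls short by at most \<epsilon>/4; doubling this and adding the
  \<epsilon>/2 lost by K gives \<epsilon>.\<close>

lemma compact_approximation_from_domain:
  fixes T :: "'x::banach \<Rightarrow>\<^sub>L 'y::real_normed_vector"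
  assumes "reflexive_space TYPE('x)" and "separable_space (euclidean :: 'x topology)"
    and "two_ball_property (compact_operators :: ('x \<Rightarrow>\<^sub>L 'x) set) id_blinfun"
    and \<epsilon>: "\<epsilon> > 0"
  obtains C where "C \<in> compact_operators" "norm (T - C) \<le> (1 + \<epsilon>) * norm T" "norm C \<ge> 2 * norm T - \<epsilon>"
proof -
  obtain x where x: "norm x \<le> 1" "norm T - \<epsilon> / 4 \<le> norm (T x)"
    by (rule norm_almost_attained[of "\<epsilon> / 4" T]) (use \<epsilon> in auto)
  obtain g :: "'y \<Rightarrow>\<^sub>L real" where g: "norm g \<le> 1" "blinfun_apply g (T x) = norm (T x)"
    by (rule norming_functional)
  have "norm (T x) \<le> norm (g o\<^sub>L T)"
    using functional_le[of "g o\<^sub>L T" x] g(2) mult_left_mono[OF x(1) norm_ge_zero[of "g o\<^sub>L T"]] by simp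
  then have gT: "norm T - \<epsilon> / 4 \<le> norm (g o\<^sub>L T)" using x(2) by linarith
  obtain K where K: "K \<in> compact_operators" "norm (id_blinfun - K) \<le> 1 + \<epsilon> / 2"
    "norm ((g o\<^sub>L T) o\<^sub>L K) \<ge> 2 * norm (g o\<^sub>L T) - \<epsilon> / 2"
    by (rule compact_approximation_domain[OF assms(1-3), of "\<epsilon> / 2" "g o\<^sub>L T"]) (use \<epsilon> in auto)
  have "(g o\<^sub>L T) o\<^sub>L K = g o\<^sub>L (T o\<^sub>L K)" by (rule blinfun_eqI) simp
  then have "norm ((g o\<^sub>L T) o\<^sub>L K) \<le> norm (T o\<^sub>L K)"
    using norm_blinfun_compose[of g "T o\<^sub>L K"] mult_right_mono[OF g(1) norm_ge_zero[of "T o\<^sub>L K"]] by simp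
  then have "norm (T o\<^sub>L K) \<ge> 2 * norm T - \<epsilon>" using K(3) gT by linarith
  moreover have "norm (T - (T o\<^sub>L K)) \<le> (1 + \<epsilon>) * norm T"
  proof -
    have "T - (T o\<^sub>L K) = T o\<^sub>L (id_blinfun - K)"
      by (rule blinfun_eqI) (simp add: blinfun.diff_left blinfun.diff_right)
    then have "norm (T - (T o\<^sub>L K)) \<le> norm T * norm (id_blinfun - K)"
      using norm_blinfun_compose by metis
    also have "\<dots> \<le> norm T * (1 + \<epsilon>)" using K(2) \<epsilon> by (intro mult_left_mono) auto
    finally show ?thesis by (simp add: mult.commute)
  qed
  ultimately show ?thesis using that[OF compact_operators_compose_left[OF K(1)]] by blast
qed

lemma compact_approximation_from_codomain:
  fixes T :: "'x::real_normed_vector \<Rightarrow>\<^sub>L 'y::banach"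
  assumes "reflexive_space TYPE('y)" and "separable_space (euclidean :: 'y topology)"
    and "two_ball_property (compact_operators :: ('y \<Rightarrow>\<^sub>L 'y) set) id_blinfun"
    and \<epsilon>: "\<epsilon> > 0"
  obtains C where "C \<in> compact_operators" "norm (T - C) \<le> (1 + \<epsilon>) * norm T" "norm C \<ge> 2 * norm T - \<epsilon>"
proof -
  obtain x where x: "norm x \<le> 1" "norm T - \<epsilon> / 4 \<le> norm (T x)"
    by (rule norm_almost_attained[of "\<epsilon> / 4" T]) (use \<epsilon> in auto)
  obtain K :: "'y \<Rightarrow>\<^sub>L 'y" where K: "K \<in> compact_operators" "norm (id_blinfun - K) \<le> 1 + \<epsilon> / 2"
    "norm (K (T x)) \<ge> 2 * norm (T x) - \<epsilon> / 2"
    by (rule compact_approximation_codomain[OF assms(1-3), of "\<epsilon> / 2" "T x"]) (use \<epsilon> in auto)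
  have "norm (K (T x)) \<le> norm (K o\<^sub>L T)"
    using norm_blinfun[of "K o\<^sub>L T" x] mult_left_mono[OF x(1) norm_ge_zero[of "K o\<^sub>L T"]] by simp
  then have "norm (K o\<^sub>L T) \<ge> 2 * norm T - \<epsilon>" using K(3) x(2) by linarith
  moreover have "norm (T - (K o\<^sub>L T)) \<le> (1 + \<epsilon>) * norm T"
  proof -
    have "T - (K o\<^sub>L T) = (id_blinfun - K) o\<^sub>L T"
      by (rule blinfun_eqI) (simp add: blinfun.diff_left)
    then have "norm (T - (K o\<^sub>L T)) \<le> norm (id_blinfun - K) * norm T"
      using norm_blinfun_compose by metis
    also have "\<dots> \<le> (1 + \<epsilon>) * norm T" using K(2) \<epsilon> by (intro mult_right_mono) auto
    finally show ?thesis .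
  qed
  ultimately show ?thesis using that[OF compact_operators_compose_right[OF K(1)]] by blast
qed

section \<open>Separability of the space of compact operators\<close>

text \<open>
  Splitting off one vector of the spanning set with a norming functional keeps all coordinates
  bounded without an appeal to the equivalence of norms in finite dimension.
\<close>

lemma finite_rank_in_span_rank_one:
  fixes R :: "'x::real_normed_vector \<Rightarrow>\<^sub>L 'y::real_normed_vector"
  assumes "finite B" "range (blinfun_apply R) \<subseteq> span B"
  shows "R \<in> span {blinfun_scaleR_left y o\<^sub>L f | y f. True}"
  using assms
proof (induction "card B" arbitrary: B R rule: less_induct)
  case less
  let ?V = "span {blinfun_scaleR_left y o\<^sub>L f | (y::'y) (f :: 'x \<Rightarrow>\<^sub>L real). True}"
  show ?case
  proof (cases "B \<subseteq> {0}")
    case True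
    then have "span B \<subseteq> {0}" using span_mono[of B "{0}"] span_insert_0[of "{}"] by auto
    then have "R = 0" using less.prems(2) by (intro blinfun_eqI) auto
    then show ?thesis by (simp add: span_zero)
  next
    case False
    then obtain b where b: "b \<in> B" "b \<noteq> 0" by blast
    obtain g0 :: "'y \<Rightarrow>\<^sub>L real" where g0: "blinfun_apply g0 b = norm b" using norming_functional by metis
    define g where "g = (1 / norm b) *\<^sub>R g0"
    have g: "blinfun_apply g b = 1" using g0 b(2) by (simp add: g_def blinfun.scaleR_left)
    \<comment> \<open>The projection along \<open>b\<close> onto the kernel of \<open>g\<close>. It
      maps \<open>b\<close> to 0, so the range of \<open>q\<close> after \<open>R\<close> is spanned
      by fewer vectors; \<open>B\<close> need not be independent for this count.\<close>
    define q where "q y = y - blinfun_apply g y *\<^sub>R b" for y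
    have q: "linear q"
      by (rule linearI) (simp_all add: q_def blinfun.add_right blinfun.scaleR_right algebra_simps)
    define R' where "R' = R - (blinfun_scaleR_left b o\<^sub>L (g o\<^sub>L R))"
    have R': "blinfun_apply R' x = q (blinfun_apply R x)" for x
      by (simp add: R'_def q_def blinfun.diff_left)
    have "q b = 0" using g by (simp add: q_def)
    have "q ` span B \<subseteq> span (q ` (B - {b}))"
    proof -
      have "q ` span B = span (q ` B)" by (rule linear_span_image[OF q, symmetric])
      also have "q ` B = insert 0 (q ` (B - {b}))" using b(1) \<open>q b = 0\<close> by force
      finally show ?thesis by (simp add: span_insert_0)
    qed
    then have "range (blinfun_apply R') \<subseteq> span (q ` (B - {b}))" using less.prems(2) R' by auto
    moreover have "card (q ` (B - {b})) < card B"
      using card_image_le[of "B - {b}" q] card_Diff1_less[OF less.prems(1) b(1)] less.prems(1) by simp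
    ultimately have "R' \<in> ?V" using less.prems(1) by (intro less.hyps) auto
    moreover have "blinfun_scaleR_left b o\<^sub>L (g o\<^sub>L R) \<in> ?V" by (rule span_base) blast
    ultimately have "R' + (blinfun_scaleR_left b o\<^sub>L (g o\<^sub>L R)) \<in> ?V" by (rule span_add)
    then show ?thesis by (simp add: R'_def)
  qed
qed

lemma subspace_closure:
  fixes V :: "'a::real_normed_vector set"
  assumes "subspace V"
  shows "subspace (closure V)"
proof (rule subspaceI)
  show "0 \<in> closure V" using subspace_0[OF assms] closure_subset by blast
next
  fix x y assume "x \<in> closure V" "y \<in> closure V"
  then obtain f g where "\<forall>n. f n \<in> V" "f \<longlonglongrightarrow> x" "\<forall>n. g n \<in> V" "g \<longlonglongrightarrow> y"
    unfolding closure_sequential by blast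
  then show "x + y \<in> closure V"
    unfolding closure_sequential
    by (intro exI[of _ "\<lambda>n. f n + g n"]) (auto intro: tendsto_add subspace_add[OF assms])
next
  fix c x assume "x \<in> closure V"
  then obtain f where "\<forall>n. f n \<in> V" "f \<longlonglongrightarrow> x" unfolding closure_sequential by blast
  then show "c *\<^sub>R x \<in> closure V"
    unfolding closure_sequential
    by (intro exI[of _ "\<lambda>n. c *\<^sub>R f n"]) (auto intro: tendsto_intros subspace_scale[OF assms])
qed

text \<open>For compact T choose S of finite rank, close to the identity on the closure of the image
  of the unit ball; then S o T is close to T in norm. Finite rank operators are sums of y \<otimes>
  f, which depend continuously on y and f, so countable dense sets of both suffice.\<close>

lemma separable_compact_operators:
  assumes "separable_space (euclidean :: ('x::real_normed_vector \<Rightarrow>\<^sub>L real) topology)"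
    and "separable_space (euclidean :: 'y::real_normed_vector topology)"
    and ap: "approximation_property TYPE('y)"
  obtains D where "countable D" "D \<subseteq> compact_operators"
    "(compact_operators :: ('x \<Rightarrow>\<^sub>L 'y) set) \<subseteq> closure D"
proof -
  obtain F :: "('x \<Rightarrow>\<^sub>L real) set" where F: "countable F" "closure F = UNIV"
    using assms(1) by (auto simp: separable_space_euclidean_iff)
  obtain G :: "'y set" where G: "countable G" "closure G = UNIV"
    using assms(2) by (auto simp: separable_space_euclidean_iff)
  define r where "r = (\<lambda>(y::'y, f :: 'x \<Rightarrow>\<^sub>L real). blinfun_scaleR_left y o\<^sub>L f)"
  obtain D where D: "countable D" "D \<subseteq> span (r ` (G \<times> F))" "span (r ` (G \<times> F)) \<subseteq> closure D"
    by (rule separable_span[of "r ` (G \<times> F)"]) (use F(1) G(1) in auto)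
  show ?thesis
  proof (rule that[OF D(1)])
    have "span (r ` (G \<times> F)) \<subseteq> compact_operators"
      by (intro span_minimal subspace_compact_operators) (auto simp: r_def rank_one_compact)
    then show "D \<subseteq> compact_operators" using D(2) by blast
    have "r (y, f) \<in> closure D" for y f
    proof -
      have "continuous_on (closure (G \<times> F)) r"
        unfolding r_def case_prod_beta
        by (intro bounded_bilinear.continuous_on[OF bounded_bilinear_blinfun_compose]
            bounded_linear.continuous_on[OF bounded_linear_blinfun_scaleR_left] continuous_intros)
      then have "r ` closure (G \<times> F) \<subseteq> closure D"
        by (rule image_closure_subset) (use D(3) span_superset[of "r ` (G \<times> F)"] in auto)
      then show ?thesis by (auto simp: closure_Times F(2) G(2))
    qed
    then have "{blinfun_scaleR_left y o\<^sub>L f | y f. True} \<subseteq> closure (span (r ` (G \<times> F)))"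
      using closure_mono[OF D(2)] by (auto simp: r_def)
    then have "span {blinfun_scaleR_left y o\<^sub>L f | (y::'y) (f::'x \<Rightarrow>\<^sub>L real). True} \<subseteq> closure (span (r ` (G \<times> F)))"
      by (rule span_minimal) (intro subspace_closure subspace_span)
    also have "\<dots> \<subseteq> closure D" by (rule closure_minimal[OF D(3) closed_closure])
    finally have rank: "span {blinfun_scaleR_left y o\<^sub>L f | (y::'y) (f::'x \<Rightarrow>\<^sub>L real). True} \<subseteq> closure D" .
    show "compact_operators \<subseteq> closure D"
    proof
      fix T :: "'x \<Rightarrow>\<^sub>L 'y" assume T: "T \<in> compact_operators"
      have "\<exists>R\<in>closure D. dist R T \<le> \<epsilon>" if \<epsilon>: "\<epsilon> > 0" for \<epsilon>
      proof -
        have "compact (closure (blinfun_apply T ` cball 0 1))" using T by (simp add: compact_operators_def)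
        then obtain S :: "'y \<Rightarrow>\<^sub>L 'y" where S: "finite_rank S"
          "\<And>y. y \<in> closure (blinfun_apply T ` cball 0 1) \<Longrightarrow> norm (blinfun_apply S y - y) \<le> \<epsilon>"
          using ap \<epsilon> unfolding approximation_property_def by metis
        obtain B where "finite B" "range (blinfun_apply S) \<subseteq> span B"
          using S(1) unfolding finite_rank_def by blast
        then have "(S o\<^sub>L T) \<in> closure D"
          using finite_rank_in_span_rank_one[of B "S o\<^sub>L T"] rank by auto
        moreover have "norm ((S o\<^sub>L T) - T) \<le> \<epsilon>"
        proof (rule norm_blinfun_le_unit)
          fix x :: 'x assume "norm x \<le> 1"
          then have "blinfun_apply T x \<in> closure (blinfun_apply T ` cball 0 1)"
            using closure_subset[of "blinfun_apply T ` cball 0 1"] by auto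
          then show "norm (blinfun_apply ((S o\<^sub>L T) - T) x) \<le> \<epsilon>"
            using S(2) by (simp add: blinfun.diff_left)
        qed (use \<epsilon> in simp)
        ultimately show ?thesis by (auto simp: dist_norm)
      qed
      then have "T \<in> closure (closure D)" unfolding closure_approachable_le by blast
      then show "T \<in> closure D" by simp
    qed
  qed
qed

section \<open>Quotient norm and the covering family\<close>

lemma quotient_norm_le: "e \<in> E \<Longrightarrow> quotient_norm E x \<le> norm (x + e)"
  unfolding quotient_norm_def by (rule cINF_lower) (auto intro: bdd_belowI2[where m = 0])

lemma quotient_norm_nonneg: "E \<noteq> {} \<Longrightarrow> 0 \<le> quotient_norm E x"
  unfolding quotient_norm_def by (rule cINF_greatest) auto

lemma quotient_norm_diff_le:
  assumes "subspace E" "z \<in> E"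
  shows "quotient_norm E (x - z) \<le> quotient_norm E x"
proof -
  have "quotient_norm E (x - z) \<le> norm (x + e)" if "e \<in> E" for e
    using quotient_norm_le[OF subspace_add[OF assms(1) that assms(2)], of "x - z"] by simp
  then show ?thesis
    unfolding quotient_norm_def[of E x] using assms by (intro cINF_greatest) auto
qed

lemma UBCP_alpha_norm:
  assumes sep: "countable D" "D \<subseteq> (compact_operators :: ('x::real_normed_vector \<Rightarrow>\<^sub>L 'y::real_normed_vector) set)"
      "(compact_operators :: ('x \<Rightarrow>\<^sub>L 'y) set) \<subseteq> closure D"
    and approx: "\<And>(T :: 'x \<Rightarrow>\<^sub>L 'y) \<epsilon>. \<epsilon> > 0 \<Longrightarrow>
      \<exists>C\<in>compact_operators. norm (T - C) \<le> (1 + \<epsilon>) * norm T \<and> norm C \<ge> 2 * norm T - \<epsilon>"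
    and \<alpha>: "1/2 < \<alpha>" "\<alpha> \<le> 1" and \<sigma>: "0 < \<sigma>" "\<sigma> < 2 * \<alpha> - 1"
  shows "UBCP (alpha_norm \<alpha> :: ('x \<Rightarrow>\<^sub>L 'y) \<Rightarrow> real) (2 * \<alpha>) (2 * \<alpha> - 1 - \<sigma>)"
proof -
  let ?E = "compact_operators :: ('x \<Rightarrow>\<^sub>L 'y) set"
  let ?N = "alpha_norm \<alpha> :: ('x \<Rightarrow>\<^sub>L 'y) \<Rightarrow> real"
  have E: "subspace ?E" by (rule subspace_compact_operators)
  have E0: "0 \<in> ?E" by (rule subspace_0[OF E])
  have q0: "quotient_norm ?E T \<ge> 0" for T using E0 by (intro quotient_norm_nonneg) auto
  have qle: "quotient_norm ?E T \<le> norm T" for T using quotient_norm_le[OF E0, of T] by simp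
  have N_ge: "\<alpha> * norm T \<le> ?N T" for T using q0[of T] \<alpha> by (simp add: alpha_norm_def)
  have N_E: "?N T = \<alpha> * norm T" if "T \<in> ?E" for T
    using quotient_norm_diff_le[OF E that, of T] quotient_norm_le[OF E0, of 0] q0[of T]
      quotient_norm_le[OF subspace_neg[OF E that], of T] by (simp add: alpha_norm_def)
  \<comment> \<open>A common point of a covering ball and the forbidden ball would give 2\<alpha> -
    \<epsilon> \<le> (2\<alpha> - 1 - \<sigma>) + (1 + \<epsilon>), that is, \<sigma> \<le>
    2\<epsilon>. The same margin puts the radius 1 + \<epsilon> below the norm of each
    centre.\<close>
  define \<epsilon> where "\<epsilon> = \<sigma> / 3"
  have \<epsilon>: "\<epsilon> > 0" "2 * \<epsilon> < \<sigma>" using \<sigma> by (auto simp: \<epsilon>_def)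
  define \<B> where "\<B> = (\<lambda>z. (z, 1 + \<epsilon>)) ` {z \<in> D. \<alpha> * norm z \<ge> 2 * \<alpha> - \<epsilon>}"
  have "countable \<B>" unfolding \<B>_def using sep(1) by (intro countable_image) (auto intro: countable_subset)
  moreover have "{T. ?N T = 1} \<subseteq> (\<Union>(c, s)\<in>\<B>. norm_cball ?N c s)"
  proof
    fix T assume "T \<in> {T. ?N T = 1}"
    then have T: "\<alpha> * norm T + (1 - \<alpha>) * quotient_norm ?E T = 1" by (simp add: alpha_norm_def)
    \<comment> \<open>As the quotient norm is at most the norm, \<alpha>-norm 1 forces norm at least
      1, which makes the centre \<open>z\<close> large. The companion bound
      \<open>\<alpha> * norm T \<le> 1\<close> makes the multiplicative error of \<open>C\<close>
      additive.\<close>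
    have "(1 - \<alpha>) * quotient_norm ?E T \<le> (1 - \<alpha>) * norm T"
      using qle \<alpha> by (intro mult_left_mono) auto
    then have T1: "norm T \<ge> 1" using T by (simp add: algebra_simps)
    have "(1 - \<alpha>) * quotient_norm ?E T \<ge> 0" using q0 \<alpha> by simp
    then have aT: "\<alpha> * norm T \<le> 1" using T by linarith
    obtain C where C: "C \<in> ?E" "norm (T - C) \<le> (1 + \<epsilon> / 2) * norm T" "norm C \<ge> 2 * norm T - \<epsilon> / 2"
      using approx[of "\<epsilon> / 2" T] \<epsilon> by auto
    have "C \<in> closure D" using C(1) sep(3) by blast
    then obtain z where z: "z \<in> D" "dist z C < \<epsilon> / 2"
      using \<epsilon> half_gt_zero[OF \<epsilon>(1)] unfolding closure_approachable by blast
    have zE: "z \<in> ?E" using z(1) sep(2) by blast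
    have Cz: "norm (C - z) \<le> \<epsilon> / 2" using z(2) by (simp add: dist_norm norm_minus_commute)
    have "norm z \<ge> 2 * norm T - \<epsilon>" using C(3) Cz norm_triangle_ineq2[of C z] by linarith
    then have "norm z \<ge> 2 - \<epsilon>" using T1 by linarith
    then have "\<alpha> * norm z \<ge> \<alpha> * (2 - \<epsilon>)" using \<alpha> by (intro mult_left_mono) auto
    moreover have "\<alpha> * \<epsilon> \<le> 1 * \<epsilon>" using \<alpha> \<epsilon> by (intro mult_right_mono) auto
    ultimately have "\<alpha> * norm z \<ge> 2 * \<alpha> - \<epsilon>" by (simp add: algebra_simps)
    with z(1) have zB: "(z, 1 + \<epsilon>) \<in> \<B>" by (simp add: \<B>_def)
    have "norm (T - z) \<le> norm (T - C) + norm (C - z)"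
      using norm_triangle_ineq[of "T - C" "C - z"] by simp
    then have "norm (T - z) \<le> (1 + \<epsilon> / 2) * norm T + \<epsilon> / 2" using C(2) Cz by linarith
    then have "\<alpha> * norm (T - z) \<le> \<alpha> * ((1 + \<epsilon> / 2) * norm T + \<epsilon> / 2)"
      using \<alpha> by (intro mult_left_mono) auto
    also have "\<dots> = \<alpha> * norm T + (\<epsilon> / 2) * (\<alpha> * norm T) + \<alpha> * (\<epsilon> / 2)" by (simp add: algebra_simps)
    also have "\<dots> \<le> \<alpha> * norm T + (\<epsilon> / 2) * 1 + 1 * (\<epsilon> / 2)"
      using aT \<alpha> \<epsilon> by (intro add_mono mult_mono order_refl) auto
    finally have "\<alpha> * norm (T - z) \<le> \<alpha> * norm T + \<epsilon>" by simp
    moreover have "(1 - \<alpha>) * quotient_norm ?E (T - z) \<le> (1 - \<alpha>) * quotient_norm ?E T"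
      using \<alpha> by (intro mult_left_mono quotient_norm_diff_le E zE) auto
    ultimately have "?N (T - z) \<le> 1 + \<epsilon>" using T unfolding alpha_norm_def by linarith
    with zB show "T \<in> (\<Union>(c, s)\<in>\<B>. norm_cball ?N c s)" by (force simp: norm_cball_def)
  qed
  moreover have "\<forall>(c, s)\<in>\<B>. 0 < s \<and> s < ?N c \<and> s \<le> 2 * \<alpha>
      \<and> norm_cball ?N c s \<inter> norm_cball ?N 0 (2 * \<alpha> - 1 - \<sigma>) = {}"
  proof (rule ballI, clarify)
    fix c s assume "(c, s) \<in> \<B>"
    then have cs: "c \<in> ?E" "\<alpha> * norm c \<ge> 2 * \<alpha> - \<epsilon>" "s = 1 + \<epsilon>"
      using sep(2) by (auto simp: \<B>_def)
    have False if w: "?N (w - c) \<le> s" "?N w \<le> 2 * \<alpha> - 1 - \<sigma>" for w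
    proof -
      \<comment> \<open>The triangle inequality is taken for the operator norm, a lower bound for
        the \<alpha>-norm after scaling by \<alpha>; at a compact \<open>c\<close> the two
        agree.\<close>
      have "\<alpha> * norm c \<le> \<alpha> * (norm w + norm (w - c))"
        using \<alpha> norm_triangle_ineq4[of w "w - c"] by (intro mult_left_mono) auto
      also have "\<dots> \<le> ?N w + ?N (w - c)" using N_ge[of w] N_ge[of "w - c"] by (simp add: distrib_left)
      finally show False using w cs \<epsilon> by linarith
    qed
    then have "norm_cball ?N c s \<inter> norm_cball ?N 0 (2 * \<alpha> - 1 - \<sigma>) = {}" by (auto simp: norm_cball_def)
    then show "0 < s \<and> s < ?N c \<and> s \<le> 2 * \<alpha> \<and> norm_cball ?N c s \<inter> norm_cball ?N 0 (2 * \<alpha> - 1 - \<sigma>) = {}"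
      using cs \<epsilon> \<sigma> \<alpha> N_E[OF cs(1)] by simp
  qed
  ultimately show ?thesis unfolding UBCP_def by blast
qed

theorem corollary3p24:
  assumes "separable_space (euclidean :: 'x::banach topology)"
    and "separable_space (euclidean :: 'y::banach topology)"
    and "reflexive_space TYPE('x)" and "reflexive_space TYPE('y)"
    and "approximation_property TYPE('x)" and "approximation_property TYPE('y)"
  shows "(u_ideal (compact_operators :: ('x \<Rightarrow>\<^sub>L 'x) set) \<or>
          u_ideal (compact_operators :: ('y \<Rightarrow>\<^sub>L 'y) set) \<longrightarrow>
          (\<forall>\<alpha> \<sigma>. 1/2 < \<alpha> \<and> \<alpha> \<le> 1 \<and> 0 < \<sigma> \<and> \<sigma> < 2 * \<alpha> - 1 \<longrightarrow>
             UBCP (alpha_norm \<alpha> :: ('x \<Rightarrow>\<^sub>L 'y) \<Rightarrow> real) (2 * \<alpha>) (2 * \<alpha> - 1 - \<sigma>)))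
       \<and> (ball_intersection_property (compact_operators :: ('x \<Rightarrow>\<^sub>L 'x) set) \<or>
          ball_intersection_property (compact_operators :: ('y \<Rightarrow>\<^sub>L 'y) set) \<longrightarrow>
          (\<forall>\<alpha> \<sigma>. 1/2 < \<alpha> \<and> \<alpha> \<le> 1 \<and> 0 < \<sigma> \<and> \<sigma> < 2 * \<alpha> - 1 \<longrightarrow>
             UBCP (alpha_norm \<alpha> :: ('x \<Rightarrow>\<^sub>L 'y) \<Rightarrow> real) (2 * \<alpha>) (2 * \<alpha> - 1 - \<sigma>)))"
proof -
  obtain D where D: "countable D" "D \<subseteq> (compact_operators :: ('x \<Rightarrow>\<^sub>L 'y) set)"
    "(compact_operators :: ('x \<Rightarrow>\<^sub>L 'y) set) \<subseteq> closure D"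
    by (rule separable_compact_operators[OF separable_dual[OF assms(3,1)] assms(2,6)])
  \<comment> \<open>The two parts share their conclusion, and each hypothesis acts through the
    two-ball property at the identity of the same space.\<close>
  have main: "UBCP (alpha_norm \<alpha> :: ('x \<Rightarrow>\<^sub>L 'y) \<Rightarrow> real) (2 * \<alpha>) (2 * \<alpha> - 1 - \<sigma>)"
    if two: "two_ball_property (compact_operators :: ('x \<Rightarrow>\<^sub>L 'x) set) id_blinfun \<or>
        two_ball_property (compact_operators :: ('y \<Rightarrow>\<^sub>L 'y) set) id_blinfun"
      and "1/2 < \<alpha> \<and> \<alpha> \<le> 1 \<and> 0 < \<sigma> \<and> \<sigma> < 2 * \<alpha> - 1" for \<alpha> \<sigma>
  proof (rule UBCP_alpha_norm[OF D])
    fix T :: "'x \<Rightarrow>\<^sub>L 'y" and \<epsilon> :: real assume \<epsilon>: "\<epsilon> > 0"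
    from two show "\<exists>C\<in>compact_operators. norm (T - C) \<le> (1 + \<epsilon>) * norm T \<and> norm C \<ge> 2 * norm T - \<epsilon>"
    proof
      assume "two_ball_property (compact_operators :: ('x \<Rightarrow>\<^sub>L 'x) set) id_blinfun"
      then show ?thesis
        by (rule compact_approximation_from_domain[OF assms(3,1) _ \<epsilon>, of T]) blast
    next
      assume "two_ball_property (compact_operators :: ('y \<Rightarrow>\<^sub>L 'y) set) id_blinfun"
      then show ?thesis
        by (rule compact_approximation_from_codomain[OF assms(4,2) _ \<epsilon>, of T]) blast
    qed
  qed (use that in auto)
  show ?thesis
    by (intro conjI impI allI main) (auto intro: u_ideal_imp_two_ball ball_intersection_imp_two_ball)
qed

end
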